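(* Let $1 \leq p < \infty$, and let $\Omega \subset \mathbb{H}$ be a non-empty open set with $3$-regular boundary. Let $p_{0} \in \partial\Omega$ and $0 < R \leq \operatorname{diam}\Omega$ (with $R<\infty$). Then $$\wp_{\Omega,p}(B(p_{0},R)) \lesssim R^{3} + \int_{B(p_{0},CR)\cap\partial\Omega} \left(\int_{0}^{R} \beta_{\partial\Omega,1}(B(q,Cr))^{p}\,\frac{dr}{r}\right)^{1/p} d\mathcal{H}^{3}(q),$$ where $C \geq 1$ is an absolute constant, and the implicit multiplicative constant may depend only on $p$ and the $3$-regularity constant of $\partial\Omega$ (in particular not on $p_0$ or $R$).
   Context: The first Heisenberg group is $\mathbb{H} = (\mathbb{R}^{3},\cdot)$ with group law $(x,y,t)\cdot(x',y',t') = (x+x',y+y',t+t'+\tfrac12(xy'-x'y))$, equipped with the metric $d(p,q) = \|q^{-1}\cdot p\|$, $\|(x,y,t)\| = \max\{|(x,y)|, 2\sqrt{|t|}\}$. Balls $B(p,r)=\{q: d(p,q)<r\}$, distances, diameters and Hausdorff measures are with respect to $d$; $dp$ denotes Lebesgue measure on $\mathbb{R}^3$. A closed set $E \subset \mathbb{H}$ is $3$-regular if there is a constant $A\geq 1$ with $A^{-1}r^3 \leq \mathcal{H}^3(E\cap B(q,r)) \leq A r^3$ for all $q\in E$ and $0<r\leq\operatorname{diam}E$, $r<\infty$. Vertical perimeter: for measurable $\Omega,U\subset\mathbb{H}$ and $s>0$, $\mathrm{v}_{\Omega}(U)(s) = \int_{U}|\chi_\Omega(p)-\chi_\Omega(p\cdot(0,0,s^2))|\,dp$,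 and $$\wp_{\Omega,p}(U) := \left(\int_0^\infty \left(\frac{\mathrm{v}_\Omega(U)(s)}{s}\right)^p\frac{ds}{s}\right)^{1/p}.$$ $\beta$-numbers: a vertical subgroup $\mathbb{W}$ is a $2$-dimensional linear subspace of $\mathbb{R}^3$ containing the $t$-axis. For $E\subset\mathbb{H}$ with locally finite $\mathcal{H}^3$ measure and $q \in E$, $$\beta_{E,1}(B(q,r)) := \inf_{\mathbb{W},z}\frac{1}{r^3}\int_{B(q,r)\cap E}\frac{\operatorname{dist}(x,z\cdot\mathbb{W})}{r}\,d\mathcal{H}^3(x),$$ the infimum being over all vertical subgroups $\mathbb{W}$ and all $z\in\mathbb{H}$. *)

theory Defs
  imports "HOL-Analysis.Analysis"
begin

section \<open>The first Heisenberg group as a metric space\<close>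

text \<open>A type of its own, so that \<open>dist\<close>, \<open>ball\<close>, \<open>open\<close>, \<open>frontier\<close> and \<open>borel\<close> are those
  of the Heisenberg metric and not those of the product metric on \<open>\<real>\<^sup>3\<close>.\<close>

datatype heis = Heis real real real

fun coords :: "heis \<Rightarrow> real \<times> real \<times> real" where
  "coords (Heis x y t) = (x, y, t)"

instantiation heis :: "{monoid_mult, inverse}"
begin

definition one_heis :: heis where
  "1 = Heis 0 0 0"

fun times_heis :: "heis \<Rightarrow> heis \<Rightarrow> heis" where
  "Heis x y t * Heis x' y' t' = Heis (x + x') (y + y') (t + t' + (x * y' - x' * y) / 2)"

fun inverse_heis :: "heis \<Rightarrow> heis" where
  "inverse (Heis x y t) = Heis (- x) (- y) (- t)"

definition divide_heis :: "heis \<Rightarrow> heis \<Rightarrow> heis" where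
  "divide_heis p q = p * inverse q"

instance
proof
  fix p q s :: heis
  show "p * q * s = p * (q * s)"
    by (cases p; cases q; cases s) (simp add: field_simps)
  show "1 * p = p" "p * 1 = p"
    by (cases p; simp add: one_heis_def)+
qed

end

lemma heis_left_inverse [simp]: "inverse p * p = (1 :: heis)"
  and heis_right_inverse [simp]: "p * inverse p = (1 :: heis)"
  by (cases p; simp add: one_heis_def)+

lemma heis_inverse_inverse [simp]: "inverse (inverse p) = (p :: heis)"
  by (cases p) simp

lemma heis_inverse_mult: "inverse (p * q) = inverse q * inverse (p :: heis)"
  by (cases p; cases q) (simp add: field_simps)

fun heis_norm :: "heis \<Rightarrow> real" where
  "heis_norm (Heis x y t) = max (sqrt (x\<^sup>2 + y\<^sup>2)) (2 * sqrt \<bar>t\<bar>)"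

lemma heis_norm_nonneg [simp]: "0 \<le> heis_norm p"
  by (cases p) (simp add: le_max_iff_disj)

lemma heis_norm_eq_0_iff: "heis_norm p = 0 \<longleftrightarrow> p = 1"
proof (cases p)
  case (Heis x y t)
  have "heis_norm p = 0 \<longleftrightarrow> sqrt (x\<^sup>2 + y\<^sup>2) \<le> 0 \<and> 2 * sqrt \<bar>t\<bar> \<le> 0"
    using heis_norm_nonneg[of p] Heis by (metis antisym_conv heis_norm.simps max.bounded_iff)
  also have "\<dots> \<longleftrightarrow> x\<^sup>2 + y\<^sup>2 = 0 \<and> t = 0"
    by (simp add: sum_power2_le_zero_iff sum_power2_eq_zero_iff)
  finally show ?thesis
    using Heis by (simp add: one_heis_def sum_power2_eq_zero_iff)
qed

lemma heis_norm_inverse [simp]: "heis_norm (inverse p) = heis_norm p"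
  by (cases p) simp

lemma heis_norm_mult_le: "heis_norm (p * q) \<le> heis_norm p + heis_norm q"
proof (cases p; cases q)
  fix x y t x' y' t'
  assume p: "p = Heis x y t" and q: "q = Heis x' y' t'"
  define a b where "a = heis_norm p" and "b = heis_norm q"
  have ab: "0 \<le> a" "0 \<le> b"
    by (simp_all add: a_def b_def)
  have z: "norm (x, y) \<le> a" "norm (x', y') \<le> b"
    by (simp_all add: a_def b_def p q norm_Pair)
  have "norm (x + x', y + y') \<le> a + b"
    using norm_triangle_ineq[of "(x, y)" "(x', y')"] z by simp
  then have 1: "sqrt ((x + x')\<^sup>2 + (y + y')\<^sup>2) \<le> a + b"
    by (simp add: norm_Pair)
  have sq: "\<bar>t\<bar> \<le> a\<^sup>2 / 4" "\<bar>t'\<bar> \<le> b\<^sup>2 / 4"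
  proof -
    have "2 * sqrt \<bar>t\<bar> \<le> a" "2 * sqrt \<bar>t'\<bar> \<le> b"
      by (simp_all add: a_def b_def p q)
    then have "(2 * sqrt \<bar>t\<bar>)\<^sup>2 \<le> a\<^sup>2" "(2 * sqrt \<bar>t'\<bar>)\<^sup>2 \<le> b\<^sup>2"
      by (intro power_mono; simp)+
    then show "\<bar>t\<bar> \<le> a\<^sup>2 / 4" "\<bar>t'\<bar> \<le> b\<^sup>2 / 4"
      by (simp_all add: power_mult_distrib)
  qed
  have "\<bar>(x, y) \<bullet> (y', - x')\<bar> \<le> norm (x, y) * norm (y', - x')"
    by (rule Cauchy_Schwarz_ineq2)
  also have "\<dots> = norm (x, y) * norm (x', y')"
    by (simp add: norm_Pair add.commute)
  also have "\<dots> \<le> a * b"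
    using z ab by (intro mult_mono) auto
  finally have "\<bar>x * y' - x' * y\<bar> \<le> a * b"
    by (simp add: algebra_simps)
  then have "\<bar>(x * y' - x' * y) / 2\<bar> \<le> a * b / 2"
    by simp
  then have "\<bar>t + t' + (x * y' - x' * y) / 2\<bar> \<le> a\<^sup>2 / 4 + b\<^sup>2 / 4 + a * b / 2"
    using sq abs_triangle_ineq[of "t + t'" "(x * y' - x' * y) / 2"] abs_triangle_ineq[of t t']
    by linarith
  also have "\<dots> = ((a + b) / 2)\<^sup>2"
    by (simp add: power2_eq_square field_simps)
  finally have "sqrt \<bar>t + t' + (x * y' - x' * y) / 2\<bar> \<le> (a + b) / 2"
    using ab by (intro real_le_lsqrt) auto
  then have "heis_norm (p * q) \<le> a + b"
    using 1 by (simp add: p q)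
  then show ?thesis
    by (simp add: a_def b_def)
qed

instantiation heis :: metric_space
begin

definition dist_heis :: "heis \<Rightarrow> heis \<Rightarrow> real" where
  "dist p q = heis_norm (inverse q * p)"

definition uniformity_heis :: "(heis \<times> heis) filter" where
  "uniformity_heis = (INF e\<in>{0<..}. principal {(p, q). dist p q < e})"

definition open_heis :: "heis set \<Rightarrow> bool" where
  "open_heis U \<longleftrightarrow> (\<forall>p\<in>U. \<forall>\<^sub>F (p', q) in uniformity. p' = p \<longrightarrow> q \<in> U)"

instance
proof
  fix p q s :: heis
  show "dist p q = 0 \<longleftrightarrow> p = q"
  proof
    assume "dist p q = 0"
    then have "inverse q * p = 1"
      by (simp add: dist_heis_def heis_norm_eq_0_iff)
    then have "(q * inverse q) * p = q"
      by (simp only: mult.assoc mult_1_right)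
    then show "p = q"
      by simp
  qed (simp add: dist_heis_def heis_norm_eq_0_iff)
  have comm: "dist p q = dist q p" for p q :: heis
    using heis_norm_inverse[of "inverse q * p"] by (simp add: dist_heis_def heis_inverse_mult)
  have "inverse q * ((s * inverse s) * p) = (inverse q * s) * (inverse s * p)"
    by (simp only: mult.assoc)
  then have "dist p q \<le> dist s q + dist p s"
    using heis_norm_mult_le[of "inverse q * s" "inverse s * p"] by (simp add: dist_heis_def)
  then show "dist p q \<le> dist p s + dist q s"
    by (simp add: comm[of q s])
  show "open U \<longleftrightarrow> (\<forall>p\<in>U. \<forall>\<^sub>F (p', q) in uniformity. p' = p \<longrightarrow> q \<in> U)" for U :: "heis set"
    by (rule open_heis_def)
qed (rule uniformity_heis_def)

end

lemma dist_Heis: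
  "dist (Heis x y t) (Heis x' y' t') =
    max (sqrt ((x - x')\<^sup>2 + (y - y')\<^sup>2)) (2 * sqrt \<bar>t - t' + (x * y' - x' * y) / 2\<bar>)"
  by (simp add: dist_heis_def)

text \<open>The metric induces the Euclidean topology, so that topological notions and Borel sets
  are the same for both.\<close>

lemma continuous_on_Heis: "continuous_on UNIV (\<lambda>(x, y, t). Heis x y t)"
proof -
  have "((\<lambda>(x, y, t). Heis x y t) \<longlongrightarrow> Heis a b c) (at (a, b, c))" for a b c
  proof -
    let ?f = "\<lambda>w :: real \<times> real \<times> real. max (sqrt ((fst w - a)\<^sup>2 + (fst (snd w) - b)\<^sup>2))
             (2 * sqrt \<bar>snd (snd w) - c + (fst w * b - a * fst (snd w)) / 2\<bar>)"
    have "isCont ?f (a, b, c)"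
      by (intro continuous_intros) simp_all
    then have "(?f \<longlongrightarrow> ?f (a, b, c)) (at (a, b, c))"
      by (simp only: isCont_def)
    moreover have "?f (a, b, c) = 0"
      by simp
    moreover have "?f = (\<lambda>w. dist (case w of (x, y, t) \<Rightarrow> Heis x y t) (Heis a b c))"
      by (simp add: case_prod_beta dist_Heis)
    ultimately have "((\<lambda>w. dist (case w of (x, y, t) \<Rightarrow> Heis x y t) (Heis a b c)) \<longlongrightarrow> 0) (at (a, b, c))"
      by simp
    then show ?thesis
      by (subst tendsto_dist_iff)
  qed
  then show ?thesis
    by (auto simp: continuous_on_def)
qed

lemma continuous_on_coords: "continuous_on UNIV coords"
proof -
  have "(coords \<longlongrightarrow> coords p) (at p)" for p
  proof -
    obtain a b c where p: "p = Heis a b c"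
      by (cases p)
    define X Y T where "X = (\<lambda>q. fst (coords q))" and "Y = (\<lambda>q. fst (snd (coords q)))"
      and "T = (\<lambda>q. snd (snd (coords q)))"
    have d0: "((\<lambda>q. dist q p) \<longlongrightarrow> 0) (at p)"
      using tendsto_dist[OF tendsto_ident_at tendsto_const, of p p UNIV] by simp
    have le: "\<bar>X q - a\<bar> \<le> dist q p" "\<bar>Y q - b\<bar> \<le> dist q p"
      "\<bar>T q - c + (X q * b - a * Y q) / 2\<bar> \<le> (dist q p)\<^sup>2" for q
    proof -
      obtain x y t where q: "q = Heis x y t"
        by (cases q)
      have "\<bar>x - a\<bar> \<le> sqrt ((x - a)\<^sup>2 + (y - b)\<^sup>2)" "\<bar>y - b\<bar> \<le> sqrt ((x - a)\<^sup>2 + (y - b)\<^sup>2)"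
        by (intro real_le_rsqrt; simp)+
      then show "\<bar>X q - a\<bar> \<le> dist q p" "\<bar>Y q - b\<bar> \<le> dist q p"
        unfolding X_def Y_def p q dist_Heis by (simp_all add: max.coboundedI1)
      have "sqrt \<bar>t - c + (x * b - a * y) / 2\<bar> \<le> dist q p"
        unfolding p q dist_Heis by (smt (verit) max.cobounded2 real_sqrt_ge_zero)
      then have "(sqrt \<bar>t - c + (x * b - a * y) / 2\<bar>)\<^sup>2 \<le> (dist q p)\<^sup>2"
        by (intro power_mono) auto
      then show "\<bar>T q - c + (X q * b - a * Y q) / 2\<bar> \<le> (dist q p)\<^sup>2"
        by (simp add: X_def Y_def T_def q)
    qed
    have X: "(X \<longlongrightarrow> a) (at p)"
      by (rule LIM_zero_cancel, rule Lim_null_comparison[OF always_eventually d0]) (simp add: le)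
    have Y: "(Y \<longlongrightarrow> b) (at p)"
      by (rule LIM_zero_cancel, rule Lim_null_comparison[OF always_eventually d0]) (simp add: le)
    have "((\<lambda>q. (dist q p)\<^sup>2) \<longlongrightarrow> 0) (at p)"
      using tendsto_power[OF d0, of 2] by simp
    then have "((\<lambda>q. T q - c + (X q * b - a * Y q) / 2) \<longlongrightarrow> 0) (at p)"
      by (rule Lim_null_comparison[OF always_eventually, rotated]) (simp add: le)
    then have "((\<lambda>q. (T q - c + (X q * b - a * Y q) / 2) + c - (X q * b - a * Y q) / 2) \<longlongrightarrow>
        0 + c - (a * b - a * b) / 2) (at p)"
      by (intro tendsto_intros X Y) auto
    then have T: "(T \<longlongrightarrow> c) (at p)"
      by simp
    have "((\<lambda>q. (X q, Y q, T q)) \<longlongrightarrow> (a, b, c)) (at p)"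
      by (intro tendsto_Pair X Y T)
    then show ?thesis
      by (simp add: X_def Y_def T_def p)
  qed
  then show ?thesis
    by (auto simp: continuous_on_def)
qed

lemma open_heis_iff: "open U \<longleftrightarrow> open (coords ` U)"
proof -
  have 1: "coords ` U = (\<lambda>(x, y, t). Heis x y t) -` U"
  proof (intro set_eqI iffI)
    fix w assume "w \<in> (\<lambda>(x, y, t). Heis x y t) -` U"
    then show "w \<in> coords ` U"
      by (cases w) (simp add: image_iff, metis coords.simps)
  next
    fix w assume "w \<in> coords ` U"
    then obtain p where "p \<in> U" "w = coords p"
      by blast
    then show "w \<in> (\<lambda>(x, y, t). Heis x y t) -` U"
      by (cases p) auto
  qed
  have "inj coords"
  proof (rule injI)
    show "p = q" if "coords p = coords q" for p q
      using that by (cases p; cases q) simp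
  qed
  then have 2: "coords -` coords ` U = U"
    by (simp add: inj_vimage_image_eq)
  show ?thesis
  proof
    assume "open U"
    then show "open (coords ` U)"
      unfolding 1 by (rule open_vimage[OF _ continuous_on_Heis])
  next
    assume "open (coords ` U)"
    from open_vimage[OF this continuous_on_coords] show "open U"
      by (simp add: 2)
  qed
qed

text \<open>Lebesgue measure of \<open>\<real>\<^sup>3\<close>, with all Lebesgue measurable sets.\<close>

definition heis_lebesgue :: "heis measure" where
  "heis_lebesgue = completion (distr lborel borel (\<lambda>(x, y, t). Heis x y t))"

lemma measurable_Heis: "(\<lambda>(x, y, t). Heis x y t) \<in> borel \<rightarrow>\<^sub>M borel"
  using continuous_on_Heis by (rule borel_measurable_continuous_onI)


section \<open>Hausdorff measures\<close>

text \<open>Extended-valued, since \<^const>\<open>diameter\<close> is meaningless for unbounded sets.\<close>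

definition ediam :: "'a :: metric_space set \<Rightarrow> ennreal" where
  "ediam S = (SUP x\<in>S. SUP y\<in>S. ennreal (dist x y))"

definition hausdorff_content :: "nat \<Rightarrow> ennreal \<Rightarrow> 'a :: metric_space set \<Rightarrow> ennreal" where
  "hausdorff_content n \<delta> E =
    (INF A\<in>{A :: nat \<Rightarrow> 'a set. E \<subseteq> (\<Union>i. A i) \<and> (\<forall>i. ediam (A i) \<le> \<delta>)}. \<Sum>i. ediam (A i) ^ n)"

text \<open>Normalised without a dimensional factor; meant for \<open>n > 0\<close>, since \<open>0 ^ 0 = 1\<close>.\<close>

definition hausdorff_outer :: "nat \<Rightarrow> 'a :: metric_space set \<Rightarrow> ennreal" where
  "hausdorff_outer n E = (SUP \<delta>\<in>{0<..}. hausdorff_content n \<delta> E)"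

definition hausdorff_measure :: "nat \<Rightarrow> 'a :: metric_space measure" where
  "hausdorff_measure n = measure_of UNIV (sets borel) (hausdorff_outer n)"

lemma ediam_mono: "S \<subseteq> T \<Longrightarrow> ediam S \<le> ediam T"
  unfolding ediam_def by (intro SUP_subset_mono) auto

lemma ediam_empty [simp]: "ediam {} = 0"
  by (simp add: ediam_def bot_ennreal)

lemma dist_le_ediam: "x \<in> S \<Longrightarrow> y \<in> S \<Longrightarrow> ennreal (dist x y) \<le> ediam S"
  unfolding ediam_def by (intro SUP_upper2[of x] SUP_upper2[of y]) auto

lemma hausdorff_content_le:
  "E \<subseteq> (\<Union>i. A i) \<Longrightarrow> (\<And>i. ediam (A i) \<le> \<delta>) \<Longrightarrow> hausdorff_content n \<delta> E \<le> (\<Sum>i. ediam (A i) ^ n)"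
  unfolding hausdorff_content_def by (intro INF_lower) auto

lemma hausdorff_content_mono: "E \<subseteq> F \<Longrightarrow> hausdorff_content n \<delta> E \<le> hausdorff_content n \<delta> F"
  unfolding hausdorff_content_def by (intro INF_superset_mono) auto

lemma hausdorff_content_antimono:
  "\<delta> \<le> \<delta>' \<Longrightarrow> hausdorff_content n \<delta>' E \<le> hausdorff_content n \<delta> E"
  unfolding hausdorff_content_def by (intro INF_superset_mono) (auto intro: order_trans)

lemma hausdorff_content_empty: "0 < n \<Longrightarrow> hausdorff_content n \<delta> {} = 0"
  using hausdorff_content_le[of "{}" "\<lambda>_. {}" \<delta> n] by (simp add: power_0_left)

lemma hausdorff_content_UN:
  "hausdorff_content n \<delta> (\<Union>k. E k) \<le> (\<Sum>k. hausdorff_content n \<delta> (E k))"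
proof (rule ennreal_le_epsilon)
  fix e :: real
  assume fin: "(\<Sum>k. hausdorff_content n \<delta> (E k)) < top" and e: "0 < e"
  have "\<exists>A. E k \<subseteq> (\<Union>i. A i) \<and> (\<forall>i. ediam (A i) \<le> \<delta>) \<and>
      (\<Sum>i. ediam (A i) ^ n) \<le> hausdorff_content n \<delta> (E k) + ennreal (e * (1/2) ^ Suc k)" for k
  proof -
    have "hausdorff_content n \<delta> (E k) < top"
      using fin ennreal_suminf_lessD by blast
    then have "hausdorff_content n \<delta> (E k) < hausdorff_content n \<delta> (E k) + ennreal (e * (1/2) ^ Suc k)"
      using e by (simp add: ennreal_zero_less_mult_iff)
    then show ?thesis
      by (subst (asm) hausdorff_content_def) (auto simp: INF_less_iff intro: less_imp_le)
  qed
  then obtain A where A: "\<And>k. E k \<subseteq> (\<Union>i. A k i)" "\<And>k i. ediam (A k i) \<le> \<delta>"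
    "\<And>k. (\<Sum>i. ediam (A k i) ^ n) \<le> hausdorff_content n \<delta> (E k) + ennreal (e * (1/2) ^ Suc k)"
    by metis
  define B where "B j = (case prod_decode j of (k, i) \<Rightarrow> A k i)" for j
  have "(\<Union>k. E k) \<subseteq> (\<Union>j. B j)"
  proof
    fix x assume "x \<in> (\<Union>k. E k)"
    then obtain k i where "x \<in> A k i"
      using A(1) by blast
    then have "x \<in> B (prod_encode (k, i))"
      by (simp add: B_def)
    then show "x \<in> (\<Union>j. B j)"
      by blast
  qed
  moreover have "ediam (B j) \<le> \<delta>" for j
    by (simp add: B_def A(2) split: prod.split)
  ultimately have "hausdorff_content n \<delta> (\<Union>k. E k) \<le> (\<Sum>j. ediam (B j) ^ n)"
    by (rule hausdorff_content_le)
  also have "\<dots> = (\<Sum>j. case_prod (\<lambda>k i. ediam (A k i) ^ n) (prod_decode j))"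
    by (simp add: B_def case_prod_beta)
  also have "\<dots> = (\<Sum>k. \<Sum>i. ediam (A k i) ^ n)"
    by (subst suminf_ennreal_2dimen[where f = "case_prod (\<lambda>k i. ediam (A k i) ^ n)", symmetric])
       (auto simp: o_def)
  also have "\<dots> \<le> (\<Sum>k. hausdorff_content n \<delta> (E k) + ennreal (e * (1/2) ^ Suc k))"
    by (intro suminf_le A) auto
  also have "\<dots> = (\<Sum>k. hausdorff_content n \<delta> (E k)) + (\<Sum>k. ennreal (e * (1/2) ^ Suc k))"
    by (rule suminf_add[symmetric]) auto
  also have "(\<Sum>k. ennreal (e * (1/2) ^ Suc k)) = ennreal e"
    using sums_mult[OF power_half_series, of e] e by (intro suminf_ennreal_eq) auto
  finally show "hausdorff_content n \<delta> (\<Union>k. E k) \<le> (\<Sum>k. hausdorff_content n \<delta> (E k)) + ennreal e" .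
qed

lemma hausdorff_outer_mono: "E \<subseteq> F \<Longrightarrow> hausdorff_outer n E \<le> hausdorff_outer n F"
  unfolding hausdorff_outer_def by (intro SUP_mono) (auto intro: hausdorff_content_mono)

lemma hausdorff_outer_empty: "0 < n \<Longrightarrow> hausdorff_outer n {} = 0"
  unfolding hausdorff_outer_def by (intro antisym SUP_least) (auto simp: hausdorff_content_empty)

lemma hausdorff_outer_UN: "hausdorff_outer n (\<Union>k. E k) \<le> (\<Sum>k. hausdorff_outer n (E k))"
  unfolding hausdorff_outer_def[of n "\<Union>k. E k"]
proof (rule SUP_least)
  fix \<delta> :: ennreal assume \<delta>: "\<delta> \<in> {0<..}"
  have "hausdorff_content n \<delta> (\<Union>k. E k) \<le> (\<Sum>k. hausdorff_content n \<delta> (E k))"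
    by (rule hausdorff_content_UN)
  also have "\<dots> \<le> (\<Sum>k. hausdorff_outer n (E k))"
    unfolding hausdorff_outer_def by (intro suminf_le SUP_upper \<delta>) auto
  finally show "hausdorff_content n \<delta> (\<Union>k. E k) \<le> (\<Sum>k. hausdorff_outer n (E k))" .
qed

lemma outer_measure_space_hausdorff:
  "0 < n \<Longrightarrow> outer_measure_space UNIV (hausdorff_outer n)"
  by (auto simp: outer_measure_space_def positive_def increasing_def countably_subadditive_def
      hausdorff_outer_empty hausdorff_outer_mono hausdorff_outer_UN)

lemma hausdorff_outer_Un:
  assumes "0 < n"
  shows "hausdorff_outer n (E \<union> F) \<le> hausdorff_outer n E + hausdorff_outer n F"
  using hausdorff_outer_UN[of n "binaryset E F"]
  unfolding UN_binaryset_eq suminf_binaryset_eq[of "hausdorff_outer n", OF hausdorff_outer_empty[OF assms]] .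

lemma hausdorff_outer_separated:
  assumes n: "0 < n" and e: "0 < e" and sep: "\<And>x y. x \<in> E \<Longrightarrow> y \<in> F \<Longrightarrow> e \<le> dist x y"
  shows "hausdorff_outer n E + hausdorff_outer n F \<le> hausdorff_outer n (E \<union> F)"
proof -
  have content: "hausdorff_content n \<delta> E + hausdorff_content n \<delta> F \<le> hausdorff_outer n (E \<union> F)"
    if \<delta>: "0 < \<delta>" "\<delta> < ennreal e" for \<delta>
  proof -
    have "hausdorff_content n \<delta> E + hausdorff_content n \<delta> F \<le> hausdorff_content n \<delta> (E \<union> F)"
      unfolding hausdorff_content_def[of n \<delta> "E \<union> F"]
    proof (rule INF_greatest, safe)
      fix A :: "nat \<Rightarrow> 'a set"
      assume A: "E \<union> F \<subseteq> (\<Union>i. A i)" "\<forall>i. ediam (A i) \<le> \<delta>"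
      have "hausdorff_content n \<delta> E \<le> (\<Sum>i. ediam (A i \<inter> E) ^ n)"
        using A by (intro hausdorff_content_le) (auto intro: order_trans[OF ediam_mono])
      moreover have "hausdorff_content n \<delta> F \<le> (\<Sum>i. ediam (A i \<inter> F) ^ n)"
        using A by (intro hausdorff_content_le) (auto intro: order_trans[OF ediam_mono])
      ultimately have "hausdorff_content n \<delta> E + hausdorff_content n \<delta> F \<le>
          (\<Sum>i. ediam (A i \<inter> E) ^ n) + (\<Sum>i. ediam (A i \<inter> F) ^ n)"
        by (rule add_mono)
      also have "\<dots> = (\<Sum>i. ediam (A i \<inter> E) ^ n + ediam (A i \<inter> F) ^ n)"
        by (rule suminf_add) auto
      also have "\<dots> \<le> (\<Sum>i. ediam (A i) ^ n)"
      proof (intro suminf_le)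
        fix i
        have "A i \<inter> E = {} \<or> A i \<inter> F = {}"
        proof (rule ccontr)
          assume "\<not> ?thesis"
          then obtain x y where xy: "x \<in> A i" "x \<in> E" "y \<in> A i" "y \<in> F"
            by blast
          have "ennreal e \<le> ennreal (dist x y)"
            using sep xy by (intro ennreal_leI) auto
          also have "\<dots> \<le> \<delta>"
            using dist_le_ediam[of x "A i" y] xy A(2) order_trans by blast
          finally show False
            using \<delta> by simp
        qed
        moreover have "ediam (A i \<inter> E) ^ n \<le> ediam (A i) ^ n" "ediam (A i \<inter> F) ^ n \<le> ediam (A i) ^ n"
          by (auto intro!: power_mono ediam_mono)
        ultimately show "ediam (A i \<inter> E) ^ n + ediam (A i \<inter> F) ^ n \<le> ediam (A i) ^ n"
          using n by (auto simp: power_0_left)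
      qed auto
      finally show "hausdorff_content n \<delta> E + hausdorff_content n \<delta> F \<le> (\<Sum>i. ediam (A i) ^ n)" .
    qed
    also have "\<dots> \<le> hausdorff_outer n (E \<union> F)"
      unfolding hausdorff_outer_def using \<delta> by (intro SUP_upper) auto
    finally show ?thesis .
  qed
  have "hausdorff_outer n E + hausdorff_outer n F =
      (SUP \<delta>\<in>{0<..}. hausdorff_content n \<delta> E + hausdorff_content n \<delta> F)"
    unfolding hausdorff_outer_def
  proof (rule SUP_add_directed_ennreal[symmetric])
    fix \<delta> \<delta>' :: ennreal assume "\<delta> \<in> {0<..}" "\<delta>' \<in> {0<..}"
    then show "\<exists>\<eta>\<in>{0<..}. hausdorff_content n \<delta> E + hausdorff_content n \<delta>' F \<le>
        hausdorff_content n \<eta> E + hausdorff_content n \<eta> F"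
      by (intro bexI[of _ "min \<delta> \<delta>'"] add_mono hausdorff_content_antimono) auto
  qed
  also have "\<dots> \<le> hausdorff_outer n (E \<union> F)"
  proof (rule SUP_least)
    fix \<delta> :: ennreal assume "\<delta> \<in> {0<..}"
    moreover obtain \<eta> where "0 < \<eta>" "\<eta> < min \<delta> (ennreal e)"
      using dense[of 0 "min \<delta> (ennreal e)"] \<open>\<delta> \<in> {0<..}\<close> e by auto
    ultimately show "hausdorff_content n \<delta> E + hausdorff_content n \<delta> F \<le> hausdorff_outer n (E \<union> F)"
      using content[of \<eta>] add_mono[OF hausdorff_content_antimono[of \<eta> \<delta> n E]
          hausdorff_content_antimono[of \<eta> \<delta> n F]] by (auto intro: order_trans less_imp_le)
  qed
  finally show ?thesis .
qed

lemma hausdorff_outer_closed: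
  fixes C A :: "'a :: metric_space set"
  assumes n: "0 < n" and C: "closed C"
  shows "hausdorff_outer n (A \<inter> C) + hausdorff_outer n (A - C) \<le> hausdorff_outer n A"
proof (cases "C = {} \<or> hausdorff_outer n A = \<infinity>")
  case True
  then show ?thesis
    using hausdorff_outer_empty[OF n, where 'a = 'a] by auto
next
  case False
  then have ne: "C \<noteq> {}" and fin: "hausdorff_outer n A < \<infinity>"
    by (auto simp: less_top)
  let ?\<mu> = "hausdorff_outer n :: 'a set \<Rightarrow> ennreal"
  define P where "P k = {x\<in>A. 1 / real (Suc k) \<le> infdist x C}" for k
  define Q where "Q k = {x\<in>A. 1 / real (Suc (Suc k)) \<le> infdist x C \<and> infdist x C < 1 / real (Suc k)}" for k
  have Q_sep: "?\<mu> (Q k) + ?\<mu> S \<le> ?\<mu> (Q k \<union> S)"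
    if S: "\<And>y. y \<in> S \<Longrightarrow> infdist y C < 1 / real (Suc (Suc (Suc k)))" for k S
  proof (rule hausdorff_outer_separated[OF n])
    show "0 < 1 / real (Suc (Suc k)) - 1 / real (Suc (Suc (Suc k)))"
      by (simp add: divide_strict_left_mono)
    fix x y assume "x \<in> Q k" "y \<in> S"
    then show "1 / real (Suc (Suc k)) - 1 / real (Suc (Suc (Suc k))) \<le> dist x y"
      using S[of y] infdist_triangle[of x C y] by (auto simp: Q_def)
  qed
  have sum_Q: "(\<Sum>k<N. ?\<mu> (Q (2 * k + i))) \<le> ?\<mu> A" for N i
  proof -
    have "(\<Sum>k<N. ?\<mu> (Q (2 * (M + k) + i))) \<le> ?\<mu> (\<Union>k<N. Q (2 * (M + k) + i))" for M
    proof (induction N arbitrary: M)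
      case 0
      then show ?case
        by simp
    next
      case (Suc N)
      have "(\<Sum>k<Suc N. ?\<mu> (Q (2 * (M + k) + i))) =
          ?\<mu> (Q (2 * M + i)) + (\<Sum>k<N. ?\<mu> (Q (2 * (Suc M + k) + i)))"
        by (subst sum.lessThan_Suc_shift) simp
      also have "\<dots> \<le> ?\<mu> (Q (2 * M + i)) + ?\<mu> (\<Union>k<N. Q (2 * (Suc M + k) + i))"
        by (intro add_left_mono Suc.IH)
      also have "\<dots> \<le> ?\<mu> (Q (2 * M + i) \<union> (\<Union>k<N. Q (2 * (Suc M + k) + i)))"
      proof (rule Q_sep)
        fix y assume "y \<in> (\<Union>k<N. Q (2 * (Suc M + k) + i))"
        then obtain k where "y \<in> Q (2 * (Suc M + k) + i)"
          by blast
        then have "infdist y C < 1 / real (Suc (2 * (Suc M + k) + i))"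
          by (simp add: Q_def)
        also have "\<dots> \<le> 1 / real (Suc (Suc (Suc (2 * M + i))))"
          by (intro divide_left_mono) auto
        finally show "infdist y C < 1 / real (Suc (Suc (Suc (2 * M + i))))" .
      qed
      also have "Q (2 * M + i) \<union> (\<Union>k<N. Q (2 * (Suc M + k) + i)) = (\<Union>k<Suc N. Q (2 * (M + k) + i))"
        by (simp add: lessThan_Suc_eq_insert_0 image_image)
      finally show ?case .
    qed
    from this[of 0] have "(\<Sum>k<N. ?\<mu> (Q (2 * k + i))) \<le> ?\<mu> (\<Union>k<N. Q (2 * k + i))"
      by simp
    also have "\<dots> \<le> ?\<mu> A"
      by (intro hausdorff_outer_mono) (auto simp: Q_def)
    finally show ?thesis .
  qed
  have "(\<Sum>k. ?\<mu> (Q k)) \<le> ?\<mu> A + ?\<mu> A"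
  proof (rule suminf_le_const)
    show "summable (\<lambda>k. ?\<mu> (Q k))"
      by simp
    fix N
    have "(\<Sum>k<N. ?\<mu> (Q k)) \<le> (\<Sum>k<2 * N. ?\<mu> (Q k))"
      by (intro sum_mono2) auto
    also have "\<dots> = (\<Sum>k<N. ?\<mu> (Q (2 * k + 0))) + (\<Sum>k<N. ?\<mu> (Q (2 * k + 1)))"
      by (induction N) (simp_all add: ac_simps)
    also have "\<dots> \<le> ?\<mu> A + ?\<mu> A"
      by (intro add_mono sum_Q)
    finally show "(\<Sum>k<N. ?\<mu> (Q k)) \<le> ?\<mu> A + ?\<mu> A" .
  qed
  then have Q_fin: "(\<Sum>k. ?\<mu> (Q k)) < \<infinity>"
    by (rule le_less_trans) (use fin in simp)
  have A_C: "A - C \<subseteq> P m \<union> (\<Union>k. Q (k + m))" for m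
  proof
    fix x assume x: "x \<in> A - C"
    then have pos: "0 < infdist x C"
      using C ne by (simp add: infdist_pos_not_in_closed)
    then obtain j where "1 / real (Suc j) < infdist x C"
      using nat_approx_posE by blast
    define l where "l = (LEAST j. 1 / real (Suc j) \<le> infdist x C)"
    have l: "1 / real (Suc l) \<le> infdist x C"
      unfolding l_def by (rule LeastI[of _ j]) (use \<open>1 / real (Suc j) < infdist x C\<close> in simp)
    show "x \<in> P m \<union> (\<Union>k. Q (k + m))"
    proof (cases "l \<le> m")
      case True
      then have "1 / real (Suc m) \<le> 1 / real (Suc l)"
        by (intro divide_left_mono) auto
      then show ?thesis
        using x l by (auto simp: P_def)
    next
      case False
      then obtain k where k: "l = Suc (k + m)"
        by (metis add.commute less_iff_Suc_add not_le)
      have "\<not> 1 / real (Suc (k + m)) \<le> infdist x C"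
        using not_less_Least[of "k + m" "\<lambda>j. 1 / real (Suc j) \<le> infdist x C", folded l_def]
      unfolding k by blast
      then have "x \<in> Q (k + m)"
        using x l by (auto simp: Q_def k)
      then show ?thesis
        by blast
    qed
  qed
  have bound: "?\<mu> (A \<inter> C) + ?\<mu> (A - C) \<le> ?\<mu> A + (\<Sum>k. ?\<mu> (Q (k + m)))" for m
  proof -
    have "?\<mu> (A - C) \<le> ?\<mu> (P m) + ?\<mu> (\<Union>k. Q (k + m))"
      using hausdorff_outer_mono[OF A_C] hausdorff_outer_Un[OF n] by (rule order_trans)
    also have "\<dots> \<le> ?\<mu> (P m) + (\<Sum>k. ?\<mu> (Q (k + m)))"
      by (intro add_left_mono hausdorff_outer_UN)
    finally have "?\<mu> (A \<inter> C) + ?\<mu> (A - C) \<le> (?\<mu> (A \<inter> C) + ?\<mu> (P m)) + (\<Sum>k. ?\<mu> (Q (k + m)))"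
      by (simp add: add.assoc add_left_mono)
    also have "?\<mu> (A \<inter> C) + ?\<mu> (P m) \<le> ?\<mu> (A \<inter> C \<union> P m)"
    proof (rule hausdorff_outer_separated[OF n])
      show "0 < 1 / real (Suc m)"
        by simp
      fix x y assume "x \<in> A \<inter> C" "y \<in> P m"
      then show "1 / real (Suc m) \<le> dist x y"
        using infdist_le[of x C y] by (auto simp: P_def dist_commute)
    qed
    also have "\<dots> \<le> ?\<mu> A"
      by (intro hausdorff_outer_mono) (auto simp: P_def)
    finally show ?thesis
      by (simp add: add_right_mono)
  qed
  define g where "g k = enn2real (?\<mu> (Q k))" for k
  have g: "?\<mu> (Q k) = ennreal (g k)" for k
    using ennreal_suminf_lessD[OF Q_fin, of k] by (simp add: g_def less_top)
  have g_nonneg: "0 \<le> g k" for k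
    by (simp add: g_def)
  have "summable g"
    using Q_fin by (intro summable_suminf_not_top g_nonneg) (simp add: g)
  then have "(\<Sum>k. ?\<mu> (Q (k + m))) = ennreal (\<Sum>k. g (k + m))" for m
    by (simp add: g g_nonneg suminf_ennreal2 summable_ignore_initial_segment)
  moreover have "(\<lambda>m. ennreal (\<Sum>k. g (k + m))) \<longlonglongrightarrow> ennreal 0"
    by (intro tendsto_ennrealI suminf_exist_split2 \<open>summable g\<close>)
  ultimately have "(\<lambda>m. \<Sum>k. ?\<mu> (Q (k + m))) \<longlonglongrightarrow> 0"
    by simp
  then have "(\<lambda>m. ?\<mu> A + (\<Sum>k. ?\<mu> (Q (k + m)))) \<longlonglongrightarrow> ?\<mu> A + 0"
    by (intro tendsto_add) auto
  then show ?thesis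
    using bound by (intro LIMSEQ_le_const) auto
qed

text \<open>Caratheodory: \<^const>\<open>hausdorff_measure\<close> is not the trivial measure that
  \<^const>\<open>measure_of\<close> would return if countable additivity failed.\<close>

lemma sets_hausdorff_measure [simp, measurable_cong]: "sets (hausdorff_measure n) = sets borel"
  using sets.sigma_sets_eq[of borel] by (simp add: hausdorff_measure_def)

lemma space_hausdorff_measure [simp]: "space (hausdorff_measure n) = UNIV"
  by (simp add: hausdorff_measure_def)

lemma emeasure_hausdorff_measure:
  assumes n: "0 < n" and B: "B \<in> sets borel"
  shows "emeasure (hausdorff_measure n) B = hausdorff_outer n B"
proof -
  let ?L = "lambda_system UNIV UNIV (hausdorff_outer n) :: 'a set set"
  interpret sigma_algebra UNIV "UNIV :: 'a set set"
    using sigma_algebra_Pow[of UNIV] by simp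
  have ms: "measure_space UNIV ?L (hausdorff_outer n)"
    by (rule caratheodory_lemma[OF outer_measure_space_hausdorff[OF n]])
  then interpret L: sigma_algebra UNIV ?L
    by (simp add: measure_space_def)
  have "C \<in> ?L" if "closed C" for C :: "'a set"
  proof -
    have "hausdorff_outer n (A \<inter> C) + hausdorff_outer n (A - C) = hausdorff_outer n A" for A
      using hausdorff_outer_closed[OF n that, of A] hausdorff_outer_Un[OF n, of "A \<inter> C" "A - C"]
      by (intro antisym) (simp_all add: Int_Diff_Un)
    then show ?thesis
      by (simp add: lambda_system_eq)
  qed
  then have "sigma_sets UNIV (Collect closed) \<subseteq> ?L"
    by (intro L.sigma_sets_subset) blast
  then have sub: "sets (borel :: 'a measure) \<subseteq> ?L"
    unfolding borel_eq_closed by simp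
  have "measure_space UNIV (sets (borel :: 'a measure)) (hausdorff_outer n)"
    by (rule measure_down[OF ms _ sub]) (use sets.sigma_algebra_axioms[of "borel :: 'a measure"] in simp)
  then show ?thesis
    using B unfolding hausdorff_measure_def
    by (intro emeasure_measure_of_sigma) (auto simp: measure_space_def)
qed

section \<open>Regular sets, vertical perimeter and beta numbers\<close>

definition three_regular :: "real \<Rightarrow> heis set \<Rightarrow> bool" where
  "three_regular A E \<longleftrightarrow> 1 \<le> A \<and> closed E \<and>
    (\<forall>q\<in>E. \<forall>r>0. ennreal r \<le> ediam E \<longrightarrow>
      ennreal (r ^ 3 / A) \<le> emeasure (hausdorff_measure 3) (E \<inter> ball q r) \<and>
      emeasure (hausdorff_measure 3) (E \<inter> ball q r) \<le> ennreal (A * r ^ 3))"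

text \<open>Powers with a positive real exponent.\<close>

definition enn_powr :: "ennreal \<Rightarrow> real \<Rightarrow> ennreal" where
  "enn_powr x a = (if x = \<infinity> then \<infinity> else ennreal (enn2real x powr a))"

definition vertical_diff :: "heis set \<Rightarrow> heis set \<Rightarrow> real \<Rightarrow> ennreal" where
  "vertical_diff \<Omega> U s =
    (\<integral>\<^sup>+p\<in>U. ennreal \<bar>indicator \<Omega> p - indicator \<Omega> (p * Heis 0 0 (s\<^sup>2))\<bar> \<partial>heis_lebesgue)"

definition vertical_perimeter :: "real \<Rightarrow> heis set \<Rightarrow> heis set \<Rightarrow> ennreal" where
  "vertical_perimeter p \<Omega> U =
    enn_powr (\<integral>\<^sup>+s\<in>{0<..}. enn_powr (vertical_diff \<Omega> U s / ennreal s) p * ennreal (1 / s) \<partial>lborel) (1 / p)"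

definition vertical_subgroup :: "heis set \<Rightarrow> bool" where
  "vertical_subgroup W \<longleftrightarrow>
    subspace (coords ` W) \<and> dim (coords ` W) = 2 \<and> (\<forall>t. Heis 0 0 t \<in> W)"

definition beta1 :: "heis set \<Rightarrow> heis \<Rightarrow> real \<Rightarrow> ennreal" where
  "beta1 E q r =
    (INF (W, z)\<in>{(W, z). vertical_subgroup W}.
      ennreal (1 / r ^ 3) *
      (\<integral>\<^sup>+x\<in>ball q r \<inter> E. ennreal (infdist x ((*) z ` W) / r) \<partial>hausdorff_measure 3))"

end

theory Submission
  imports Defs
begin

text \<open>Write \<open>E\<close> for the frontier of \<open>\<Omega>\<close>, and call a point \<open>p\<close> a jump point at scale \<open>s\<close> if exactly
  one of \<open>p\<close> and \<open>p \<cdot> (0, 0, s\<^sup>2)\<close> lies in \<open>\<Omega>\<close>. A jump point has a point of \<open>E\<close> within distance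
  \<open>2s\<close>, so by regularity and Fubini the measure of the jump points in \<open>B(p\<^sub>0, R)\<close> is at most
  \<open>A / s\<^sup>3\<close> times the integral over \<open>q \<in> E\<close> of the measure of the jump points in \<open>B(q, 3s)\<close>. The latter is
  bounded by \<open>A s\<^sup>4 \<beta>(B(q, C s))\<close>: given a vertical plane, either some point of \<open>E\<close> near \<open>q\<close> has
  distance at least \<open>s\<close> from it, and a single ball in \<open>E\<close> makes the integral in \<open>\<beta>\<close> large, or moving
  horizontally away from the plane from a jump point or its translate hits \<open>E\<close> in a point whose
  distance from the plane exceeds the distance travelled, and a further use of Fubini applies.
  Minkowski's integral inequality turns these bounds for \<open>s \<le> min R (diam E)\<close> into the assertion; for
  larger \<open>s\<close> the measure of the jump points is trivially \<open>O (min R (diam E) ^ 4)\<close>.\<close>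

section \<open>Minkowski's integral inequality\<close>

lemma enn_powr_ennreal [simp]: "0 \<le> x \<Longrightarrow> enn_powr (ennreal x) a = ennreal (x powr a)"
  by (simp add: enn_powr_def)

lemma enn_powr_top [simp]: "enn_powr \<infinity> a = \<infinity>" "enn_powr top a = top"
  by (simp_all add: enn_powr_def)

lemma enn_powr_0 [simp]: "enn_powr 0 a = 0"
  by (simp add: enn_powr_def)

lemma enn_powr_eq_top_iff [simp]: "enn_powr x a = top \<longleftrightarrow> x = top"
  by (simp add: enn_powr_def)

lemma enn_powr_eq_0_iff [simp]: "enn_powr x a = 0 \<longleftrightarrow> x = 0"
  by (cases x) (auto simp: ennreal_eq_0_iff)

lemma enn_powr_mono: "0 \<le> a \<Longrightarrow> x \<le> y \<Longrightarrow> enn_powr x a \<le> enn_powr y a"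
  by (cases x; cases y) (auto intro!: ennreal_leI powr_mono2 simp: top_unique)

lemma enn_powr_powr: "enn_powr (enn_powr x a) b = enn_powr x (a * b)"
  by (cases x) (auto simp: powr_powr)

lemma enn_powr_one [simp]: "enn_powr x 1 = x"
  by (cases x) auto

lemma enn_powr_mult_left: "0 < c \<Longrightarrow> enn_powr (ennreal c * x) a = ennreal (c powr a) * enn_powr x a"
  by (cases x) (auto simp: powr_mult ennreal_mult_top simp flip: ennreal_mult)

lemma measurable_enn_powr [measurable (raw)]:
  "f \<in> borel_measurable M \<Longrightarrow> (\<lambda>x. enn_powr (f x) a) \<in> borel_measurable M"
proof -
  have "(\<lambda>x. enn_powr x a) \<in> borel_measurable (borel :: ennreal measure)"
    unfolding enn_powr_def by (intro measurable_If) simp_all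
  then show "f \<in> borel_measurable M \<Longrightarrow> (\<lambda>x. enn_powr (f x) a) \<in> borel_measurable M"
    by (rule measurable_compose[rotated])
qed

text \<open>The sum is at most twice the larger term, and the exponent \<open>1 / p\<close> is at
  most 1. This stands in for the triangle inequality when the integral over the scales is split in
  two.\<close>

lemma enn_powr_add_le:
  assumes "1 \<le> p"
  shows "enn_powr (x + y) (1 / p) \<le> 2 * (enn_powr x (1 / p) + enn_powr y (1 / p))"
proof -
  have *: "enn_powr (u + v) (1 / p) \<le> 2 * (enn_powr u (1 / p) + enn_powr v (1 / p))" if "u \<le> v" for u v
  proof -
    have "enn_powr (u + v) (1 / p) \<le> enn_powr (ennreal 2 * v) (1 / p)"
      using assms that by (intro enn_powr_mono) (auto simp: mult_2 add_right_mono)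
    also have "\<dots> = ennreal (2 powr (1 / p)) * enn_powr v (1 / p)"
      by (rule enn_powr_mult_left) simp
    also have "\<dots> \<le> 2 * enn_powr v (1 / p)"
    proof -
      have "2 powr (1 / p) \<le> (2::real) powr 1"
        using assms by (intro powr_mono) auto
      then show ?thesis
        by (intro mult_right_mono) (auto simp: ennreal_le_iff[symmetric] simp del: ennreal_le_iff)
    qed
    also have "\<dots> \<le> 2 * (enn_powr u (1 / p) + enn_powr v (1 / p))"
      by (intro mult_left_mono) auto
    finally show ?thesis .
  qed
  show ?thesis
    using *[of x y] *[of y x] by (cases "x \<le> y") (auto simp: add.commute)
qed

section \<open>Young's and Hoelder's inequalities\<close>

lemma Young_powr:
  fixes a b p :: real
  assumes "0 \<le> a" "0 \<le> b" "1 \<le> p"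
  shows "a powr (p - 1) * b \<le> (1 - 1 / p) * a powr p + 1 / p * b powr p"
proof (cases "p = 1")
  case True
  then show ?thesis
    \<comment> \<open>For \<open>p = 1\<close> there is no conjugate exponent
      \<open>p / (p - 1)\<close>. As \<open>0 powr 0\<close> is 0, the case \<open>a = 0\<close> is
      separate.\<close>
    using assms by (cases "a = 0") auto
next
  case False
  then have p: "1 < p" using assms by simp
  have "a powr (p - 1) * b \<le> (a powr (p - 1)) powr (p / (p - 1)) / (p / (p - 1)) + b powr p / p"
    using assms p by (intro Youngs_inequality) (auto simp: field_simps)
  also have "(a powr (p - 1)) powr (p / (p - 1)) = a powr p"
    using p by (simp add: powr_powr)
  finally show ?thesis
    using p by (simp add: field_simps)
qed

text \<open>Only the dual function \<open>f powr (p - 1)\<close> is paired with \<open>g\<close>, so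
  no conjugate exponent appears. After division of \<open>f\<close> by its norm \<open>J\<close> and
  of \<open>g\<close> by its norm, \<open>Young_powr\<close> holds pointwise, and the integrals of
  its right side add up to \<open>1 - 1 / p + 1 / p\<close>.\<close>

lemma nn_integral_Holder:
  fixes f :: "'a \<Rightarrow> real" and g :: "'a \<Rightarrow> ennreal"
  assumes p: "1 \<le> p" and [measurable]: "f \<in> borel_measurable M" "g \<in> borel_measurable M"
    and f: "\<And>x. 0 \<le> f x" and J: "0 < J"
    and fJ: "(\<integral>\<^sup>+x. ennreal (f x powr p) \<partial>M) = ennreal (J powr p)"
  shows "(\<integral>\<^sup>+x. ennreal (f x powr (p - 1)) * g x \<partial>M) \<le>
    ennreal (J powr (p - 1)) * enn_powr (\<integral>\<^sup>+x. enn_powr (g x) p \<partial>M) (1 / p)"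
proof -
  define G where "G = (\<integral>\<^sup>+x. enn_powr (g x) p \<partial>M)"
  consider "G = 0" | "G = top" | r where "0 < r" "G = ennreal r"
    by (cases G) (auto simp: less_le)
  then show ?thesis
  proof cases
    case 1
    then have "AE x in M. g x = 0"
      by (simp add: G_def nn_integral_0_iff_AE)
    then have "(\<integral>\<^sup>+x. ennreal (f x powr (p - 1)) * g x \<partial>M) = (\<integral>\<^sup>+x. 0 \<partial>M)"
      by (intro nn_integral_cong_AE) auto
    then show ?thesis by simp
  next
    case 2
    then show ?thesis
      using J by (simp add: G_def[symmetric] ennreal_mult_top)
  next
    case (3 r)
    define N where "N = r powr (1 / p)"
    have N: "0 < N" "N powr p = r"
      using 3 p by (auto simp: N_def powr_powr)
    \<comment> \<open>Finiteness of \<open>G\<close> makes \<open>g\<close> finite almost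
      everywhere, so that the real inequality of Young applies.\<close>
    have fin: "AE x in M. g x \<noteq> top"
      using nn_integral_noteq_infinite[of "\<lambda>x. enn_powr (g x) p" M] 3 by (simp add: G_def)
    have le: "ennreal (f x powr (p - 1)) * g x \<le>
       ennreal (J powr (p - 1) * N) * (ennreal ((1 - 1 / p) / J powr p) * ennreal (f x powr p) +
           ennreal (1 / p / r) * enn_powr (g x) p)"
      if "g x \<noteq> top" for x
    proof -
      from that obtain u where u: "g x = ennreal u" "0 \<le> u"
        by (cases "g x") auto
      have "(f x / J) powr (p - 1) * (u / N) \<le> (1 - 1 / p) * (f x / J) powr p + 1 / p * (u / N) powr p"
        using J N f u p by (intro Young_powr) auto
      then have "f x powr (p - 1) * u / (J powr (p - 1) * N) \<le>
          (1 - 1 / p) / J powr p * f x powr p + 1 / p / r * u powr p"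
        using J N f u by (simp add: powr_divide)
      then have "f x powr (p - 1) * u \<le>
          (J powr (p - 1) * N) * ((1 - 1 / p) / J powr p * f x powr p + 1 / p / r * u powr p)"
        using J N by (simp add: pos_divide_le_eq mult.commute)
      then have "ennreal (f x powr (p - 1) * u) \<le>
          ennreal ((J powr (p - 1) * N) * ((1 - 1 / p) / J powr p * f x powr p + 1 / p / r * u powr p))"
        by (rule ennreal_leI)
      also have "\<dots> = ennreal (J powr (p - 1) * N) * (ennreal ((1 - 1 / p) / J powr p) * ennreal (f x powr p) +
           ennreal (1 / p / r) * ennreal (u powr p))"
        using J(1) N(1) p 3(1) by (simp add: ennreal_mult[symmetric] ennreal_plus[symmetric] del: ennreal_plus)
      finally show ?thesis
        using u by (simp add: ennreal_mult)
    qed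
    have "(\<integral>\<^sup>+x. ennreal (f x powr (p - 1)) * g x \<partial>M) \<le>
       (\<integral>\<^sup>+x. ennreal (J powr (p - 1) * N) * (ennreal ((1 - 1 / p) / J powr p) * ennreal (f x powr p) +
           ennreal (1 / p / r) * enn_powr (g x) p) \<partial>M)"
      using fin le by (intro nn_integral_mono_AE) auto
    also have "\<dots> = ennreal (J powr (p - 1) * N) *
        (ennreal ((1 - 1 / p) / J powr p) * ennreal (J powr p) + ennreal (1 / p / r) * ennreal r)"
      by (simp add: nn_integral_cmult nn_integral_add fJ G_def[symmetric] 3(2))
    also have "ennreal ((1 - 1 / p) / J powr p) * ennreal (J powr p) + ennreal (1 / p / r) * ennreal r = 1"
      using J p 3 by (simp add: ennreal_mult[symmetric] ennreal_plus[symmetric] field_simps del: ennreal_plus)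
    finally show ?thesis
      using 3 J by (simp add: G_def[symmetric] N_def ennreal_mult)
  qed
qed

section \<open>Truncation and Minkowski's inequality\<close>

text \<open>Truncation loses nothing in the limit. For \<open>x = top\<close>, the truncation at
  \<open>m\<close> has power at least \<open>n\<close> as soon as \<open>m\<close> exceeds the
  \<open>p\<close>-th root of \<open>n\<close>.\<close>

lemma SUP_enn_powr_min:
  assumes "0 < p"
  shows "(SUP n. enn_powr (min x (of_nat n)) p) = enn_powr x p"
proof (cases "x = top")
  case True
  have "(SUP n. enn_powr (min x (of_nat n)) p) = top"
  proof (rule ennreal_SUP_eq_top)
    fix n :: nat
    obtain m :: nat where m: "max 1 (real n) powr (1 / p) \<le> real m"
      using real_arch_simple by blast
    have "real n \<le> (max 1 (real n) powr (1 / p)) powr p"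
      using assms by (simp add: powr_powr)
    also have "\<dots> \<le> real m powr p"
      using m assms by (intro powr_mono2) auto
    finally have "of_nat n \<le> enn_powr (min x (of_nat m)) p"
      using True by (simp add: min_def top_unique ennreal_of_nat_eq_real_of_nat)
    then show "\<exists>i\<in>UNIV. of_nat n \<le> enn_powr (min x (of_nat i)) p"
      by blast
  qed
  then show ?thesis using True by simp
next
  case False
  then obtain n :: nat where n: "x \<le> of_nat n"
    by (metis ennreal_Ex_less_of_nat less_imp_le less_top)
  show ?thesis
  proof (rule antisym)
    show "(SUP n. enn_powr (min x (of_nat n)) p) \<le> enn_powr x p"
      using assms by (intro SUP_least enn_powr_mono) auto
    show "enn_powr x p \<le> (SUP n. enn_powr (min x (of_nat n)) p)"
      using n by (intro SUP_upper2[of n]) (auto simp: min_def)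
  qed
qed

text \<open>Let \<open>F\<close> be the inner integral and \<open>f n\<close> a truncation of it
  with norm \<open>J\<close>. The integral of \<open>f n powr p\<close> is at most that of
  \<open>f n powr (p - 1) * F\<close>, which Fubini and \<open>nn_integral_Holder\<close> for each
  \<open>y\<close> bound by \<open>J powr (p - 1) * T\<close>. Truncation in height and to a set of
  finite measure makes \<open>J\<close> finite, so a power of it can be cancelled; monotone
  convergence then removes the truncation.\<close>

theorem nn_integral_Minkowski:
  fixes g :: "'a \<times> 'b \<Rightarrow> ennreal"
  assumes M: "sigma_finite_measure M" and N: "sigma_finite_measure N" and p: "1 \<le> p"
    and g [measurable]: "g \<in> borel_measurable (M \<Otimes>\<^sub>M N)"
  shows "enn_powr (\<integral>\<^sup>+x. enn_powr (\<integral>\<^sup>+y. g (x, y) \<partial>N) p \<partial>M) (1 / p) \<le>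
    (\<integral>\<^sup>+y. enn_powr (\<integral>\<^sup>+x. enn_powr (g (x, y)) p \<partial>M) (1 / p) \<partial>N)"
proof -
  interpret M: sigma_finite_measure M by fact
  interpret N: sigma_finite_measure N by fact
  interpret MN: pair_sigma_finite M N ..
  define F where "F x = (\<integral>\<^sup>+y. g (x, y) \<partial>N)" for x
  define T where "T = (\<integral>\<^sup>+y. enn_powr (\<integral>\<^sup>+x. enn_powr (g (x, y)) p \<partial>M) (1 / p) \<partial>N)"
  have F [measurable]: "F \<in> borel_measurable M"
    unfolding F_def by measurable
  obtain A :: "nat \<Rightarrow> 'a set" where A: "range A \<subseteq> sets M" "(\<Union>i. A i) = space M"
      "\<And>i. emeasure M (A i) \<noteq> \<infinity>" "incseq A"
    by (rule M.sigma_finite_incseq) auto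
  then have A_sets [measurable]: "A i \<in> sets M" for i by auto
  define f where "f n x = enn2real (min (F x) (of_nat n)) * indicator (A n) x" for n x
  have f_meas [measurable]: "f n \<in> borel_measurable M" for n
    unfolding f_def by measurable
  have f_ennreal: "ennreal (f n x) = min (F x) (of_nat n) * indicator (A n) x" for n x
  proof -
    have "min (F x) (of_nat n) < top"
      by (simp add: min_less_iff_disj of_nat_less_top)
    then show ?thesis
      by (simp add: f_def indicator_def)
  qed
  have f_pos: "0 \<le> f n x" for n x
    by (simp add: f_def)
  have f_le_n: "f n x \<le> real n * indicator (A n) x" for n x
  proof -
    have "enn2real (min (F x) (of_nat n)) \<le> enn2real (of_nat n)"
      by (intro enn2real_mono) (auto simp: less_top[symmetric])
    then show ?thesis
      by (auto simp: f_def indicator_def)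
  qed
  have bound: "(\<integral>\<^sup>+x. ennreal (f n x powr p) \<partial>M) \<le> enn_powr T p" for n
  proof -
    have "(\<integral>\<^sup>+x. ennreal (f n x powr p) \<partial>M) \<le> (\<integral>\<^sup>+x. ennreal (real n powr p) * indicator (A n) x \<partial>M)"
    proof (intro nn_integral_mono)
      fix x
      show "ennreal (f n x powr p) \<le> ennreal (real n powr p) * indicator (A n) x"
        using f_le_n[of n x] f_pos[of n x] p
        by (auto simp: indicator_def intro!: ennreal_leI powr_mono2 split: if_splits)
    qed
    also have "\<dots> < top"
      using A(3)[of n] by (simp add: nn_integral_cmult ennreal_mult_less_top less_top)
    finally obtain j where j: "(\<integral>\<^sup>+x. ennreal (f n x powr p) \<partial>M) = ennreal j" "0 \<le> j"
      by (metis ennreal_cases less_irrefl)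
    show ?thesis
    proof (cases "j = 0 \<or> T = top")
      case True
      then show ?thesis using j by auto
    next
      case False
      define J where "J = j powr (1 / p)"
      have J: "0 < J" "J powr p = j"
        using False j p by (auto simp: J_def powr_powr)
      have "ennreal (J powr p) = (\<integral>\<^sup>+x. ennreal (f n x powr (p - 1)) * ennreal (f n x) \<partial>M)"
        unfolding J j(1)[symmetric]
        by (intro nn_integral_cong) (simp add: f_pos ennreal_mult[symmetric] powr_mult_base mult.commute[of "_ powr _"])
      also have "\<dots> \<le> (\<integral>\<^sup>+x. ennreal (f n x powr (p - 1)) * F x \<partial>M)"
        by (intro nn_integral_mono mult_left_mono) (auto simp: f_ennreal indicator_def)
      also have "\<dots> = (\<integral>\<^sup>+x. (\<integral>\<^sup>+y. ennreal (f n x powr (p - 1)) * g (x, y) \<partial>N) \<partial>M)"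
        unfolding F_def by (intro nn_integral_cong nn_integral_cmult[symmetric]) measurable
      also have "\<dots> = (\<integral>\<^sup>+y. (\<integral>\<^sup>+x. ennreal (f n x powr (p - 1)) * g (x, y) \<partial>M) \<partial>N)"
        by (intro MN.Fubini'[symmetric]) measurable
      also have "\<dots> \<le> (\<integral>\<^sup>+y. ennreal (J powr (p - 1)) *
          enn_powr (\<integral>\<^sup>+x. enn_powr (g (x, y)) p \<partial>M) (1 / p) \<partial>N)"
        using p J j f_pos by (intro nn_integral_mono nn_integral_Holder) auto
      also have "\<dots> = ennreal (J powr (p - 1)) * T"
        unfolding T_def by (intro nn_integral_cmult) measurable
      finally have *: "ennreal (J powr p) \<le> ennreal (J powr (p - 1)) * T" .
      from False obtain t where t: "T = ennreal t" "0 \<le> t"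
        by (cases T) auto
      have "J powr p \<le> J powr (p - 1) * t"
        using * t by (simp add: ennreal_mult[symmetric])
      also have "J powr p = J powr (p - 1) * J"
        using J by (metis powr_mult_base less_imp_le add.commute diff_add_cancel mult.commute)
      finally have "J \<le> t"
        using J by simp
      then have "J powr p \<le> t powr p"
        using J p by (intro powr_mono2) auto
      then show ?thesis
        using j J t by (simp add: ennreal_leI)
    qed
  qed
  have mono: "incseq (\<lambda>n x. ennreal (f n x powr p))"
  proof (intro incseq_SucI le_funI)
    fix n x
    have "ennreal (f n x) \<le> ennreal (f (Suc n) x)"
    proof -
      have "A n \<subseteq> A (Suc n)" using A(4) by (simp add: incseq_Suc_iff)
      moreover have "min (F x) (of_nat n) \<le> min (F x) (of_nat (Suc n))"
        by (intro min.mono) (auto simp del: of_nat_Suc)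
      ultimately show ?thesis
        unfolding f_ennreal by (auto simp: indicator_def simp del: of_nat_Suc)
    qed
    then show "ennreal (f n x powr p) \<le> ennreal (f (Suc n) x powr p)"
      using f_pos p by (intro ennreal_leI powr_mono2) (auto simp: ennreal_le_iff)
  qed
  have sup: "(SUP n. ennreal (f n x powr p)) = enn_powr (F x) p" if x: "x \<in> space M" for x
  proof -
    from A(2) x obtain m where m: "x \<in> A m" by blast
    have A_m: "x \<in> A n" if "m \<le> n" for n
      using A(4) m that by (auto dest: incseqD)
    have eq: "ennreal (f n x powr p) = enn_powr (min (F x) (of_nat n) * indicator (A n) x) p" for n
      using f_ennreal[of n x] f_pos[of n x] by (metis enn_powr_ennreal)
    show ?thesis
    proof (rule antisym)
      show "(SUP n. ennreal (f n x powr p)) \<le> enn_powr (F x) p"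
        unfolding eq using p by (intro SUP_least enn_powr_mono) (auto simp: indicator_def)
      have "(SUP n. enn_powr (min (F x) (of_nat n)) p) \<le> (SUP n. ennreal (f n x powr p))"
      proof (rule SUP_mono)
        fix n :: nat
        have "enn_powr (min (F x) (of_nat n)) p \<le> ennreal (f (max m n) x powr p)"
          unfolding eq using p A_m[of "max m n"]
          by (intro enn_powr_mono) (auto intro: min.coboundedI2)
        then show "\<exists>k\<in>UNIV. enn_powr (min (F x) (of_nat n)) p \<le> ennreal (f k x powr p)"
          by blast
      qed
      then show "enn_powr (F x) p \<le> (SUP n. ennreal (f n x powr p))"
        using SUP_enn_powr_min[of p "F x"] p by simp
    qed
  qed
  have "(\<integral>\<^sup>+x. enn_powr (F x) p \<partial>M) = (\<integral>\<^sup>+x. (SUP n. ennreal (f n x powr p)) \<partial>M)"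
    by (intro nn_integral_cong) (simp add: sup)
  also have "\<dots> = (SUP n. \<integral>\<^sup>+x. ennreal (f n x powr p) \<partial>M)"
    by (intro nn_integral_monotone_convergence_SUP mono) measurable
  also have "\<dots> \<le> enn_powr T p"
    by (intro SUP_least bound)
  finally have "enn_powr (\<integral>\<^sup>+x. enn_powr (F x) p \<partial>M) (1 / p) \<le> enn_powr (enn_powr T p) (1 / p)"
    using p by (intro enn_powr_mono) auto
  then show ?thesis
    using p by (simp add: enn_powr_powr F_def T_def)
qed

section \<open>Lebesgue measure, translations and vertical planes in the Heisenberg group\<close>

lemma continuous_on_Heis_comp [continuous_intros]:
  assumes "continuous_on S f" "continuous_on S g" "continuous_on S h"
  shows "continuous_on S (\<lambda>w. Heis (f w) (g w) (h w))"
proof -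
  have "continuous_on S ((\<lambda>(x, y, t). Heis x y t) \<circ> (\<lambda>w. (f w, g w, h w)))"
    by (rule continuous_on_compose[OF _ continuous_on_subset[OF continuous_on_Heis]])
      (auto intro!: continuous_intros assms)
  then show ?thesis
    by (simp add: o_def)
qed

lemma inj_coords: "inj coords"
proof (rule injI)
  show "p = q" if "coords p = coords q" for p q
    using that by (cases p; cases q) simp
qed

text \<open>A Euclidean basis is pulled back along \<open>coords\<close>. Second countability makes
  \<open>dist\<close> jointly measurable for the product of the Borel sigma-algebras, and it
  supplies countable dense sets.\<close>

instance heis :: second_countable_topology
proof
  obtain \<B> :: "(real \<times> real \<times> real) set set" where \<B>: "countable \<B>" "topological_basis \<B>"
    using ex_countable_basis by blast
  have "topological_basis ((\<lambda>X. coords -` X) ` \<B>)"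
  proof (rule topological_basisI)
    show "open U" if "U \<in> (\<lambda>X. coords -` X) ` \<B>" for U
      using that \<B>(2) continuous_on_coords by (auto intro: open_vimage topological_basis_open)
    fix U and p :: heis
    assume "open U" "p \<in> U"
    then have "open (coords ` U)" "coords p \<in> coords ` U"
      by (auto simp: open_heis_iff)
    then obtain B where "B \<in> \<B>" "coords p \<in> B" "B \<subseteq> coords ` U"
      using \<B>(2) by (meson topological_basisE)
    then show "\<exists>B'\<in>(\<lambda>X. coords -` X) ` \<B>. p \<in> B' \<and> B' \<subseteq> U"
      by (intro bexI[of _ "coords -` B"]) (use inj_image_mem_iff[OF inj_coords] in blast)+
  qed
  then show "\<exists>\<B>::heis set set. countable \<B> \<and> open = generate_topology \<B>"
    using \<B>(1) by (metis countable_image topological_basis_imp_subbasis)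
qed

section \<open>Lebesgue measure and coordinate boxes\<close>

text \<open>This is \<open>heis_lebesgue\<close> before completion. Its measurable sets are the
  Borel sets, which suits joint measurability and Fubini, and by
  \<open>nn_integral_heis_lebesgue\<close> the integrals are the same.\<close>

definition heis_lborel :: "heis measure" where
  "heis_lborel = distr lborel borel (\<lambda>(x, y, t). Heis x y t)"

lemma sets_heis_lborel [simp, measurable_cong]: "sets heis_lborel = sets borel"
  and space_heis_lborel [simp]: "space heis_lborel = UNIV"
  by (simp_all add: heis_lborel_def)

lemma nn_integral_heis_lebesgue: "integral\<^sup>N heis_lebesgue f = integral\<^sup>N heis_lborel f"
  by (simp add: heis_lebesgue_def heis_lborel_def nn_integral_completion)

lemma emeasure_heis_lborel:
  assumes "X \<in> sets borel"
  shows "emeasure heis_lborel X = emeasure lborel ((\<lambda>(x, y, t). Heis x y t) -` X)"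
  using assms measurable_Heis by (simp add: heis_lborel_def emeasure_distr)

text \<open>A substitute for balls that is convex in coordinates and whose measure is explicit.\<close>

fun hbox :: "heis \<Rightarrow> real \<Rightarrow> heis set" where
  "hbox (Heis a b c) r =
    {Heis x y t |x y t. \<bar>x - a\<bar> \<le> r \<and> \<bar>y - b\<bar> \<le> r \<and> \<bar>t - c + (x * b - a * y) / 2\<bar> \<le> r\<^sup>2 / 4}"

lemma Heis_in_hbox:
  "Heis x y t \<in> hbox (Heis a b c) r \<longleftrightarrow>
    \<bar>x - a\<bar> \<le> r \<and> \<bar>y - b\<bar> \<le> r \<and> \<bar>t - c + (x * b - a * y) / 2\<bar> \<le> r\<^sup>2 / 4"
  by auto

lemma vimage_hbox:
  "(\<lambda>(x, y, t). Heis x y t) -` hbox (Heis a b c) r =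
    {(x, y, t). \<bar>x - a\<bar> \<le> r \<and> \<bar>y - b\<bar> \<le> r \<and> \<bar>t - c + (x * b - a * y) / 2\<bar> \<le> r\<^sup>2 / 4}"
  by auto

lemma cball_subset_hbox: "cball q r \<subseteq> hbox q r"
proof
  fix p assume "p \<in> cball q r"
  then have d: "dist p q \<le> r" by (simp add: dist_commute)
  obtain x y t where p: "p = Heis x y t" by (cases p)
  obtain a b c where q: "q = Heis a b c" by (cases q)
  have 1: "sqrt ((x - a)\<^sup>2 + (y - b)\<^sup>2) \<le> r" "2 * sqrt \<bar>t - c + (x * b - a * y) / 2\<bar> \<le> r"
    using d by (simp_all add: p q dist_Heis)
  have "\<bar>x - a\<bar> \<le> sqrt ((x - a)\<^sup>2 + (y - b)\<^sup>2)" "\<bar>y - b\<bar> \<le> sqrt ((x - a)\<^sup>2 + (y - b)\<^sup>2)"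
    by (intro real_le_rsqrt; simp)+
  then have 2: "\<bar>x - a\<bar> \<le> r" "\<bar>y - b\<bar> \<le> r"
    using 1(1) by linarith+
  have "(2 * sqrt \<bar>t - c + (x * b - a * y) / 2\<bar>)\<^sup>2 \<le> r\<^sup>2"
    using 1(2) by (intro power_mono) auto
  then show "p \<in> hbox q r"
    using 2 unfolding p q Heis_in_hbox by (simp add: power_mult_distrib)
qed

lemma closed_hbox [measurable]: "closed (hbox q r)"
proof (cases q)
  case (Heis a b c)
  have cont: "continuous_on UNIV (\<lambda>p. fst (coords p))" "continuous_on UNIV (\<lambda>p. fst (snd (coords p)))"
    "continuous_on UNIV (\<lambda>p. snd (snd (coords p)))"
    by (intro continuous_intros continuous_on_coords)+
  have "hbox q r = {p. \<bar>fst (coords p) - a\<bar> \<le> r \<and> \<bar>fst (snd (coords p)) - b\<bar> \<le> r \<and>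
      \<bar>snd (snd (coords p)) - c + (fst (coords p) * b - a * fst (snd (coords p))) / 2\<bar> \<le> r\<^sup>2 / 4}"
  proof (intro set_eqI)
    fix p show "p \<in> hbox q r \<longleftrightarrow> p \<in> {p. \<bar>fst (coords p) - a\<bar> \<le> r \<and> \<bar>fst (snd (coords p)) - b\<bar> \<le> r \<and>
      \<bar>snd (snd (coords p)) - c + (fst (coords p) * b - a * fst (snd (coords p))) / 2\<bar> \<le> r\<^sup>2 / 4}"
      by (cases p) (simp add: Heis)
  qed
  also have "closed \<dots>"
    by (intro closed_Collect_conj closed_Collect_le continuous_intros cont) auto
  finally show ?thesis .
qed

lemma hbox_borel [measurable]: "hbox q r \<in> sets borel"
  by (simp add: closed_hbox borel_closed)

text \<open>The skew term only shifts the slices in the direction of \<open>t\<close>: each is an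
  interval of length \<open>r\<^sup>2 / 2\<close> over a square of side
  \<open>2 * r\<close>.\<close>

lemma emeasure_hbox: "0 \<le> r \<Longrightarrow> emeasure heis_lborel (hbox q r) = ennreal (2 * r ^ 4)"
proof (cases q)
  case (Heis a b c)
  assume r: "0 \<le> r"
  let ?B = "{(x, y, t). \<bar>x - a\<bar> \<le> r \<and> \<bar>y - b\<bar> \<le> r \<and> \<bar>t - c + (x * b - a * y) / 2\<bar> \<le> r\<^sup>2 / 4}"
  have "emeasure heis_lborel (hbox q r) = emeasure lborel ?B"
    unfolding Heis using emeasure_heis_lborel[OF hbox_borel, of "Heis a b c" r] vimage_hbox[of a b c r] by simp
  also have "\<dots> = (\<integral>\<^sup>+w. indicator ?B w \<partial>(lborel \<Otimes>\<^sub>M (lborel \<Otimes>\<^sub>M lborel)))"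
  proof -
    have "closed ?B"
      unfolding case_prod_beta
      by (intro closed_Collect_conj closed_Collect_le continuous_intros) auto
    then have "?B \<in> sets borel" by simp
    then show ?thesis
      unfolding lborel_prod by simp
  qed
  also have "\<dots> = (\<integral>\<^sup>+x. \<integral>\<^sup>+y. \<integral>\<^sup>+t. indicator ?B (x, y, t) \<partial>lborel \<partial>lborel \<partial>lborel)"
  proof -
    have B: "Measurable.pred (borel \<Otimes>\<^sub>M borel \<Otimes>\<^sub>M borel) (\<lambda>(x, y, t). \<bar>x - a\<bar> \<le> r \<and> \<bar>y - b\<bar> \<le> r \<and> \<bar>t - c + (x * b - a * y) / 2\<bar> \<le> r\<^sup>2 / 4)"
      by measurable
    then have [measurable]: "?B \<in> sets (borel \<Otimes>\<^sub>M borel \<Otimes>\<^sub>M borel)"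
      by (simp add: pred_def space_pair_measure)
    have "sigma_finite_measure (lborel \<Otimes>\<^sub>M lborel :: (real \<times> real) measure)"
      unfolding lborel_prod by (rule lborel.sigma_finite_measure_axioms)
    note P = sigma_finite_measure.nn_integral_fst[OF this, symmetric]
    have "(\<integral>\<^sup>+w. indicator ?B w \<partial>(lborel \<Otimes>\<^sub>M (lborel \<Otimes>\<^sub>M lborel))) =
        (\<integral>\<^sup>+x. \<integral>\<^sup>+w. indicator ?B (x, w) \<partial>(lborel \<Otimes>\<^sub>M lborel) \<partial>lborel :: ennreal)"
      by (rule P) measurable
    also have "\<dots> = (\<integral>\<^sup>+x. \<integral>\<^sup>+y. \<integral>\<^sup>+t. indicator ?B (x, y, t) \<partial>lborel \<partial>lborel \<partial>lborel)"
      by (intro nn_integral_cong lborel.nn_integral_fst[symmetric]) measurable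
    finally show ?thesis .
  qed
  also have "\<dots> = (\<integral>\<^sup>+x. \<integral>\<^sup>+y. ennreal (r\<^sup>2 / 2) * indicator {b - r..b + r} y * indicator {a - r..a + r} x \<partial>lborel \<partial>lborel)"
  proof (intro nn_integral_cong)
    fix x y
    have "indicator ?B (x, y, t) = indicator {a - r..a + r} x * (indicator {b - r..b + r} y *
        (indicator {c - (x * b - a * y) / 2 - r\<^sup>2 / 4..c - (x * b - a * y) / 2 + r\<^sup>2 / 4} t :: ennreal))" for t
    proof -
      have "\<bar>t - c + u\<bar> \<le> v \<longleftrightarrow> t \<in> {c - u - v..c - u + v}" for u v
        by auto
      then have *: "(x, y, t) \<in> ?B \<longleftrightarrow> x \<in> {a - r..a + r} \<and> y \<in> {b - r..b + r} \<and>
          t \<in> {c - (x * b - a * y) / 2 - r\<^sup>2 / 4..c - (x * b - a * y) / 2 + r\<^sup>2 / 4}"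
        by (auto simp only: split_def mem_Collect_eq fst_conv snd_conv atLeastAtMost_iff abs_le_iff)
      show ?thesis
        unfolding indicator_def * by simp
    qed
    then show "(\<integral>\<^sup>+t. indicator ?B (x, y, t) \<partial>lborel) =
        ennreal (r\<^sup>2 / 2) * indicator {b - r..b + r} y * indicator {a - r..a + r} x"
      by (simp add: nn_integral_cmult mult_ac)
  qed
  also have "\<dots> = ennreal (r\<^sup>2 / 2) * ennreal (2 * r) * ennreal (2 * r)"
    using r by (simp add: nn_integral_cmult nn_integral_multc)
  also have "\<dots> = ennreal (2 * r ^ 4)"
    using r by (simp add: ennreal_mult[symmetric] power2_eq_square power4_eq_xxxx)
  finally show ?thesis .
qed

lemma emeasure_ball_le: "emeasure heis_lborel (ball q r) \<le> ennreal (2 * r ^ 4)"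
proof (cases "0 \<le> r")
  case True
  have "emeasure heis_lborel (ball q r) \<le> emeasure heis_lborel (hbox q r)"
    using cball_subset_hbox[of q r] ball_subset_cball[of q r] by (intro emeasure_mono) auto
  then show ?thesis
    using True by (simp add: emeasure_hbox)
qed (simp add: not_le ball_empty)

lemma sigma_finite_heis_lborel: "sigma_finite_measure heis_lborel"
proof
  let ?A = "range (\<lambda>n::nat. ball (1 :: heis) (real n))"
  have "(\<Union>n. ball (1 :: heis) (real n)) = UNIV"
    by (auto intro: reals_Archimedean2)
  moreover have "emeasure heis_lborel (ball 1 (real n)) \<noteq> \<infinity>" for n
    using emeasure_ball_le[of 1 "real n"] by (auto simp: top_unique)
  ultimately show "\<exists>A. countable A \<and> A \<subseteq> sets heis_lborel \<and> \<Union> A = space heis_lborel \<and>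
      (\<forall>a\<in>A. emeasure heis_lborel a \<noteq> \<infinity>)"
    by (intro exI[of _ ?A]) auto
qed

text \<open>In coordinates the box is an intersection of six half-spaces and bounded, and the
  complement of a bounded convex set in dimension at least 2 is connected.\<close>

lemma connected_Compl_hbox: "connected (- hbox q r)"
proof (cases q)
  case (Heis a b c)
  let ?S = "(\<lambda>(x, y, t). Heis x y t) -` hbox q r"
  have S: "?S = {(x, y, t). \<bar>x - a\<bar> \<le> r \<and> \<bar>y - b\<bar> \<le> r \<and> \<bar>t - c + (x * b - a * y) / 2\<bar> \<le> r\<^sup>2 / 4}"
    unfolding Heis by (rule vimage_hbox)
  have halves: "?S = {w. (1, 0, 0) \<bullet> w \<le> a + r} \<inter> {w. (1, 0, 0) \<bullet> w \<ge> a - r} \<inter>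
      {w. (0, 1, 0) \<bullet> w \<le> b + r} \<inter> {w. (0, 1, 0) \<bullet> w \<ge> b - r} \<inter>
      {w. (b / 2, - a / 2, 1) \<bullet> w \<le> c + r\<^sup>2 / 4} \<inter> {w. (b / 2, - a / 2, 1) \<bullet> w \<ge> c - r\<^sup>2 / 4}"
  proof (intro set_eqI)
    fix w
    obtain x y t :: real where w: "w = (x, y, t)" by (cases w)
    have "\<bar>t - c + (x * b - a * y) / 2\<bar> \<le> r\<^sup>2 / 4 \<longleftrightarrow>
        b * x / 2 + (t - a * y / 2) \<le> c + r\<^sup>2 / 4 \<and> c - r\<^sup>2 / 4 \<le> b * x / 2 + (t - a * y / 2)"
    proof -
      have "(x * b - a * y) / 2 = b * x / 2 - a * y / 2"
        by (simp add: diff_divide_distrib)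
      then show ?thesis
        by linarith
    qed
    then show "w \<in> ?S \<longleftrightarrow> w \<in> {w. (1, 0, 0) \<bullet> w \<le> a + r} \<inter> {w. (1, 0, 0) \<bullet> w \<ge> a - r} \<inter>
      {w. (0, 1, 0) \<bullet> w \<le> b + r} \<inter> {w. (0, 1, 0) \<bullet> w \<ge> b - r} \<inter>
      {w. (b / 2, - a / 2, 1) \<bullet> w \<le> c + r\<^sup>2 / 4} \<inter> {w. (b / 2, - a / 2, 1) \<bullet> w \<ge> c - r\<^sup>2 / 4}"
      unfolding S w by (auto simp: abs_le_iff)
  qed
  have "convex ?S"
    unfolding halves by (intro convex_Int convex_halfspace_le convex_halfspace_ge)
  moreover have "bounded ?S"
  proof -
    \<comment> \<open>On the set, \<open>P\<close> and \<open>Q\<close> bound the two products in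
      the skew term, and hence \<open>l\<close> bounds \<open>t\<close>.\<close>
    define P Q where "P = (\<bar>a\<bar> + r) * \<bar>b\<bar>" and "Q = \<bar>a\<bar> * (\<bar>b\<bar> + r)"
    define l where "l = \<bar>c\<bar> + r\<^sup>2 / 4 + P + Q"
    have "bounded (cbox (a - r, b - r, - l) (a + r, b + r, l))"
      by (rule bounded_cbox)
    moreover have "?S \<subseteq> cbox (a - r, b - r, - l) (a + r, b + r, l)"
    proof
      fix w assume "w \<in> ?S"
      moreover obtain x y t where w: "w = (x, y, t)" by (cases w)
      ultimately have 1: "\<bar>x - a\<bar> \<le> r" "\<bar>y - b\<bar> \<le> r" "\<bar>t - c + (x * b - a * y) / 2\<bar> \<le> r\<^sup>2 / 4"
        unfolding S by auto
      have "\<bar>x * b\<bar> \<le> P" "\<bar>a * y\<bar> \<le> Q"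
        unfolding P_def Q_def abs_mult using 1 by (intro mult_mono; linarith)+
      moreover from this have "0 \<le> P" "0 \<le> Q"
        using abs_ge_zero order_trans by blast+
      ultimately have "- (P + Q) \<le> (x * b - a * y) / 2" "(x * b - a * y) / 2 \<le> P + Q"
        unfolding abs_le_iff by argo+
      then have "- l \<le> t" "t \<le> l"
        using 1(3) unfolding l_def by linarith+
      with 1 show "w \<in> cbox (a - r, b - r, - l) (a + r, b + r, l)"
        unfolding w cbox_Pair_eq by auto
    qed
    ultimately show ?thesis
      by (rule bounded_subset)
  qed
  ultimately have "connected (- ?S)"
    by (intro connected_complement_bounded_convex) simp_all
  then have "connected ((\<lambda>(x, y, t). Heis x y t) ` (- ?S))"
    by (rule connected_continuous_image[rotated]) (rule continuous_on_subset[OF continuous_on_Heis], simp)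
  also have "(\<lambda>(x, y, t). Heis x y t) ` (- ?S) = - hbox q r"
  proof (intro set_eqI iffI)
    fix p assume "p \<in> - hbox q r"
    then show "p \<in> (\<lambda>(x, y, t). Heis x y t) ` (- ?S)"
      by (cases p) (auto intro!: image_eqI[of _ _ "coords p"])
  qed auto
  finally show ?thesis .
qed

section \<open>Vertical and horizontal translations, vertical planes\<close>

text \<open>\<open>Heis 0 0 u\<close> is central, so this right translation is also a left
  translation and therefore an isometry.\<close>

definition vshift :: "real \<Rightarrow> heis \<Rightarrow> heis" where
  "vshift u p = p * Heis 0 0 u"

lemma vshift_Heis [simp]: "vshift u (Heis x y t) = Heis x y (t + u)"
  by (simp add: vshift_def)

lemma vshift_0 [simp]: "vshift 0 p = p"
  by (cases p) simp

lemma dist_vshift [simp]: "dist (vshift u p) (vshift u q) = dist p q"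
  by (cases p; cases q) (simp add: dist_Heis)

lemma dist_vshift_self: "dist (vshift u p) p = 2 * sqrt \<bar>u\<bar>"
  by (cases p) (simp add: dist_Heis)

lemma dist_vshift_left: "dist (vshift u p) q = dist p (vshift (- u) q)"
  by (cases p; cases q) (simp add: dist_Heis algebra_simps)

lemma vimage_vshift_ball: "vshift u -` ball q r = ball (vshift (- u) q) r"
  by (auto simp: dist_vshift_left dist_commute[of q] dist_commute[of "vshift (- u) q"])

lemma vimage_vshift_hbox: "vshift u -` hbox q r = hbox (vshift (- u) q) r"
proof (cases q)
  case (Heis a b c)
  show ?thesis
  proof (intro set_eqI)
    fix p show "p \<in> vshift u -` hbox q r \<longleftrightarrow> p \<in> hbox (vshift (- u) q) r"
      using Heis by (cases p) (simp add: Heis_in_hbox algebra_simps del: hbox.simps)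
  qed
qed

lemma continuous_on_vshift: "continuous_on UNIV (vshift u)"
  by (auto simp: continuous_on_iff)

lemma measurable_vshift [measurable]: "vshift u \<in> borel \<rightarrow>\<^sub>M borel"
  by (intro borel_measurable_continuous_onI continuous_on_vshift)

lemma connected_vshift_segment: "connected ((\<lambda>u. vshift u p) ` {0..u})"
proof -
  have "continuous_on {0..u} (\<lambda>u. vshift u p)"
    by (cases p) (auto intro!: continuous_intros)
  then show ?thesis
    by (rule connected_continuous_image) simp
qed

text \<open>Right multiplication by a horizontal element is in general no isometry, but it displaces
  every point by the Euclidean length of \<open>(a, b)\<close> and commutes with
  \<open>vshift\<close>.\<close>

definition hshift :: "real \<Rightarrow> real \<Rightarrow> heis \<Rightarrow> heis" where
  "hshift a b p = p * Heis a b 0"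

lemma dist_hshift_self: "dist (hshift a b p) p = sqrt (a\<^sup>2 + b\<^sup>2)"
  by (cases p) (simp add: hshift_def dist_Heis algebra_simps diff_divide_distrib)

lemma hshift_vshift: "hshift a b (vshift u p) = vshift u (hshift a b p)"
  by (cases p) (simp add: hshift_def)

lemma continuous_on_hshift_segment: "continuous_on S (\<lambda>\<tau>. hshift (\<tau> * a) (\<tau> * b) p)"
  by (cases p) (auto simp: hshift_def intro!: continuous_intros)

lemma connected_hshift_segment: "connected ((\<lambda>\<tau>. hshift (\<tau> * a) (\<tau> * b) p) ` {0..s})"
  by (rule connected_continuous_image[OF continuous_on_hshift_segment]) simp

text \<open>Signed; the Heisenberg distance to a left coset of a vertical subgroup is the planar distance to
  the line below the coset.\<close>

definition line_dist :: "real \<Rightarrow> real \<Rightarrow> real \<Rightarrow> heis \<Rightarrow> real" where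
  "line_dist a b c p = a * fst (coords p) + b * fst (snd (coords p)) - c"

lemma line_dist_Heis [simp]: "line_dist a b c (Heis x y t) = a * x + b * y - c"
  by (simp add: line_dist_def)

lemma line_dist_vshift [simp]: "line_dist a b c (vshift u p) = line_dist a b c p"
  by (cases p) simp

text \<open>Along the unit normal the signed distance grows as fast as the point moves. This ties
  the time at which a path hits the frontier to the distance of the hitting point from the
  plane.\<close>

lemma line_dist_hshift:
  "a\<^sup>2 + b\<^sup>2 = 1 \<Longrightarrow> line_dist a b c (hshift (\<tau> * a) (\<tau> * b) p) = line_dist a b c p + \<tau>"
proof (cases p)
  case (Heis x y t)
  assume "a\<^sup>2 + b\<^sup>2 = 1"
  then have "\<tau> * (a * a + b * b) = \<tau>"
    by (simp add: power2_eq_square)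
  then show ?thesis
    using Heis by (simp add: hshift_def algebra_simps)
qed

lemma line_dist_lipschitz:
  assumes ab: "a\<^sup>2 + b\<^sup>2 = 1"
  shows "\<bar>line_dist a b c p - line_dist a b c q\<bar> \<le> dist p q"
proof (cases p; cases q)
  fix x y t x' y' t'
  assume p: "p = Heis x y t" and q: "q = Heis x' y' t'"
  have "\<bar>(a, b) \<bullet> (x - x', y - y')\<bar> \<le> norm (a, b) * norm (x - x', y - y')"
    by (rule Cauchy_Schwarz_ineq2)
  also have "\<dots> = sqrt ((x - x')\<^sup>2 + (y - y')\<^sup>2)"
    by (simp add: norm_Pair ab)
  also have "\<dots> \<le> dist p q"
    by (simp add: p q dist_Heis)
  finally show ?thesis
    by (simp add: p q algebra_simps)
qed

lemma continuous_on_line_dist: "continuous_on UNIV (line_dist a b c)"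
  unfolding line_dist_def by (intro continuous_intros continuous_on_coords)

lemma measurable_line_dist [measurable]: "line_dist a b c \<in> borel_measurable borel"
  by (intro borel_measurable_continuous_onI continuous_on_line_dist)

text \<open>Points on the plane have no side towards which to move away from it; this allows them to
  be discarded.\<close>

lemma null_line_dist:
  assumes "a\<^sup>2 + b\<^sup>2 = 1"
  shows "emeasure heis_lborel {p. line_dist a b c p = 0} = 0"
proof -
  have "{p. line_dist a b c p = 0} \<in> sets borel"
    by (intro borel_closed closed_Collect_eq continuous_on_line_dist) simp
  then have "emeasure heis_lborel {p. line_dist a b c p = 0} =
      emeasure lborel ((\<lambda>(x, y, t). Heis x y t) -` {p. line_dist a b c p = 0})"
    by (rule emeasure_heis_lborel)
  also have "(\<lambda>(x, y, t). Heis x y t) -` {p. line_dist a b c p = 0} = {w. (a, b, 0 :: real) \<bullet> w = c}"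
    by auto
  also have "emeasure lborel {w. (a, b, 0 :: real) \<bullet> w = c} = 0"
  proof -
    have "(a, b, 0) \<noteq> (0 :: real \<times> real \<times> real)"
      using assms by (auto simp: zero_prod_def)
    then have "negligible {w. (a, b, 0::real) \<bullet> w = c}"
      by (intro negligible_hyperplane) auto
    moreover have "{w. (a, b, 0::real) \<bullet> w = c} \<in> sets borel"
      by (intro borel_closed closed_hyperplane)
    ultimately show ?thesis
      by (simp add: negligible_iff_null_sets null_sets_def emeasure_completion)
  qed
  finally show ?thesis .
qed

text \<open>A two-dimensional subspace has a normal vector, and containing the \<open>t\<close>-axis
  forces its last entry to vanish; normalised, it gives \<open>a\<close> and \<open>b\<close>, and
  translation by \<open>z\<close> gives \<open>c\<close>. The distance is attained by moving
  horizontally along the normal, and \<open>line_dist_lipschitz\<close> is the lower bound.\<close>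

lemma infdist_vertical_coset:
  assumes "vertical_subgroup W"
  obtains a b c where "a\<^sup>2 + b\<^sup>2 = 1" "\<And>p. infdist p ((*) z ` W) = \<bar>line_dist a b c p\<bar>"
proof -
  have sub: "subspace (coords ` W)" and dim: "dim (coords ` W) = DIM(real \<times> real \<times> real) - 1"
    and vert: "\<And>t. Heis 0 0 t \<in> W"
    using assms by (auto simp: vertical_subgroup_def)
  from dim obtain n where n: "n \<noteq> 0" "span (coords ` W) = {x. n \<bullet> x = 0}"
    unfolding dim_eq_hyperplane by blast
  then have W: "coords ` W = {x. n \<bullet> x = 0}"
    using sub by (simp add: span_eq_iff[THEN iffD2])
  obtain n1 n2 n3 where n123: "n = (n1, n2, n3)" by (cases n)
  have "coords (Heis 0 0 1) \<in> coords ` W" using vert by blast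
  then have n3: "n3 = 0"
    unfolding W n123 by simp
  define m where "m = sqrt (n1\<^sup>2 + n2\<^sup>2)"
  have "n1\<^sup>2 + n2\<^sup>2 \<noteq> 0"
    using n(1) by (auto simp: n123 n3 zero_prod_def sum_power2_eq_zero_iff)
  then have m: "0 < m" "m\<^sup>2 = n1\<^sup>2 + n2\<^sup>2"
    by (auto simp: m_def less_le)
  define a b where "a = n1 / m" and "b = n2 / m"
  have ab: "a\<^sup>2 + b\<^sup>2 = 1"
    using m(1) by (simp add: a_def b_def power_divide add_divide_distrib[symmetric] m(2)[symmetric])
  define c where "c = a * fst (coords z) + b * fst (snd (coords z))"
  have inW: "w \<in> W \<longleftrightarrow> line_dist a b 0 w = 0" for w
  proof -
    have "w \<in> W \<longleftrightarrow> coords w \<in> coords ` W"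
      by (simp add: inj_image_mem_iff inj_coords)
    also have "\<dots> \<longleftrightarrow> line_dist a b 0 w = 0"
      using m(1) unfolding W n123 n3 by (cases w) (simp add: a_def b_def field_simps)
    finally show ?thesis .
  qed
  have coset: "w \<in> (*) z ` W \<longleftrightarrow> line_dist a b c w = 0" for w
  proof
    assume "w \<in> (*) z ` W"
    then obtain v where "v \<in> W" "w = z * v" by blast
    then show "line_dist a b c w = 0"
      unfolding inW c_def by (cases z; cases v) (simp add: algebra_simps)
  next
    assume "line_dist a b c w = 0"
    then have "inverse z * w \<in> W"
      unfolding inW c_def by (cases z; cases w) (simp add: algebra_simps)
    moreover have "w = z * (inverse z * w)"
      by (simp add: mult.assoc[symmetric])
    ultimately show "w \<in> (*) z ` W" by blast
  qed
  have "infdist p ((*) z ` W) = \<bar>line_dist a b c p\<bar>" for p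
  proof (rule antisym)
    let ?\<tau> = "- line_dist a b c p"
    have "hshift (?\<tau> * a) (?\<tau> * b) p \<in> (*) z ` W"
      unfolding coset by (subst line_dist_hshift[OF ab]) simp
    then have "infdist p ((*) z ` W) \<le> dist p (hshift (?\<tau> * a) (?\<tau> * b) p)"
      by (rule infdist_le)
    also have "\<dots> = sqrt (?\<tau>\<^sup>2 * (a\<^sup>2 + b\<^sup>2))"
      by (simp only: dist_commute[of p] dist_hshift_self power_mult_distrib distrib_left)
    also have "\<dots> = \<bar>line_dist a b c p\<bar>"
      by (simp add: ab)
    finally show "infdist p ((*) z ` W) \<le> \<bar>line_dist a b c p\<bar>" .
    have ne: "(*) z ` W \<noteq> {}" using vert by blast
    show "\<bar>line_dist a b c p\<bar> \<le> infdist p ((*) z ` W)"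
      unfolding infdist_notempty[OF ne]
    proof (rule cINF_greatest[OF ne])
      fix w assume "w \<in> (*) z ` W"
      then show "\<bar>line_dist a b c p\<bar> \<le> dist p w"
        using line_dist_lipschitz[OF ab, of c p w] by (simp add: coset)
    qed
  qed
  with ab show ?thesis
    by (rule that)
qed

section \<open>Jump points of a set with regular frontier\<close>

text \<open>A measure on the whole group concentrated on \<open>E\<close>. Unlike
  \<open>hausdorff_measure 3\<close> itself it is sigma-finite in the cases of interest, as Fubini
  and Minkowski require.\<close>

definition surface_measure :: "heis set \<Rightarrow> heis measure" where
  "surface_measure E = density (hausdorff_measure 3) (indicator E)"

lemma sets_surface_measure [simp, measurable_cong]: "sets (surface_measure E) = sets borel"
  and space_surface_measure [simp]: "space (surface_measure E) = UNIV"
  by (simp_all add: surface_measure_def)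

lemma nn_integral_surface_measure:
  assumes "closed E" "f \<in> borel_measurable borel"
  shows "(\<integral>\<^sup>+x. f x \<partial>surface_measure E) = (\<integral>\<^sup>+x. f x * indicator E x \<partial>hausdorff_measure 3)"
proof -
  have "f \<in> borel_measurable (hausdorff_measure 3)"
    "(indicator E :: heis \<Rightarrow> ennreal) \<in> borel_measurable (hausdorff_measure 3)"
    using assms by (simp_all add: measurable_cong_sets[OF sets_hausdorff_measure refl] borel_measurable_indicator borel_closed)
  then show ?thesis
    unfolding surface_measure_def by (simp add: nn_integral_density mult.commute)
qed

lemma emeasure_surface_measure:
  assumes "closed E" "X \<in> sets borel"
  shows "emeasure (surface_measure E) X = emeasure (hausdorff_measure 3) (E \<inter> X)"
proof -
  have "emeasure (surface_measure E) X = (\<integral>\<^sup>+x. indicator X x \<partial>surface_measure E)"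
    using assms by simp
  also have "\<dots> = (\<integral>\<^sup>+x. indicator (E \<inter> X) x \<partial>hausdorff_measure 3)"
    unfolding indicator_inter_arith using assms
    by (subst nn_integral_surface_measure) (simp_all add: mult.commute)
  also have "\<dots> = emeasure (hausdorff_measure 3) (E \<inter> X)"
    using assms by (intro nn_integral_indicator) (simp add: borel_closed)
  finally show ?thesis .
qed

lemma three_regular_surface_ball:
  assumes "three_regular A E" "q \<in> E" "0 < r" "ennreal r \<le> ediam E"
  shows "ennreal (r ^ 3 / A) \<le> emeasure (surface_measure E) (ball q r)"
    and "emeasure (surface_measure E) (ball q r) \<le> ennreal (A * r ^ 3)"
  using assms by (auto simp: three_regular_def emeasure_surface_measure)

text \<open>The complement of \<open>E\<close> is null, and countably many balls of the one
  admissible radius \<open>r\<close>, centred in a dense subset of \<open>E\<close>, cover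
  \<open>E\<close> with finite mass each.\<close>

lemma sigma_finite_surface_measure:
  assumes reg: "three_regular A E" and r: "0 < r" "ennreal r \<le> ediam E"
  shows "sigma_finite_measure (surface_measure E)"
proof
  have cl: "closed E" using reg by (simp add: three_regular_def)
  obtain T where T: "countable T" "T \<subseteq> E" "E \<subseteq> closure T"
    using separable by blast
  let ?A = "insert (- E) ((\<lambda>t. ball t r) ` T)"
  have "\<Union> ?A = UNIV"
  proof (rule equalityI[OF subset_UNIV subsetI])
    fix x :: heis
    show "x \<in> \<Union> ?A"
    proof (cases "x \<in> E")
      case True
      then obtain t where "t \<in> T" "dist t x < r"
        using T(3) r(1) by (meson closure_approachable subsetD)
      then show ?thesis by auto
    qed simp
  qed
  moreover have "emeasure (surface_measure E) (- E) = 0"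
    using cl by (subst emeasure_surface_measure) (auto simp: borel_closed)
  moreover have "emeasure (surface_measure E) (ball t r) \<noteq> \<infinity>" if "t \<in> T" for t
    using three_regular_surface_ball(2)[OF reg _ r, of t] T(2) that by (auto simp: top_unique)
  ultimately show "\<exists>A. countable A \<and> A \<subseteq> sets (surface_measure E) \<and> \<Union> A = space (surface_measure E) \<and>
      (\<forall>a\<in>A. emeasure (surface_measure E) a \<noteq> \<infinity>)"
    using T(1) cl by (intro exI[of _ ?A]) (auto simp: borel_closed)
qed

section \<open>Jump points and the frontier points they lead to\<close>

definition vertical_jump :: "heis set \<Rightarrow> real \<Rightarrow> heis set" where
  "vertical_jump \<Omega> s = {p. (p \<in> \<Omega>) \<noteq> (vshift (s\<^sup>2) p \<in> \<Omega>)}"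

lemma vertical_jump_borel [measurable]:
  assumes "open \<Omega>"
  shows "vertical_jump \<Omega> s \<in> sets borel"
proof -
  have [measurable]: "\<Omega> \<in> sets borel" using assms by simp
  have "{p \<in> space borel. (p \<in> \<Omega>) \<noteq> (vshift (s\<^sup>2) p \<in> \<Omega>)} \<in> sets borel"
    by measurable
  then show ?thesis by (simp add: vertical_jump_def)
qed

lemma vertical_diff_eq:
  assumes "open \<Omega>" "U \<in> sets borel"
  shows "vertical_diff \<Omega> U s = emeasure heis_lborel (vertical_jump \<Omega> s \<inter> U)"
proof -
  have "vertical_diff \<Omega> U s = (\<integral>\<^sup>+p. indicator (vertical_jump \<Omega> s \<inter> U) p \<partial>heis_lborel)"
    unfolding vertical_diff_def nn_integral_heis_lebesgue
    by (intro nn_integral_cong) (auto simp: vertical_jump_def vshift_def indicator_def)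
  then show ?thesis
    using assms vertical_jump_borel[OF assms(1)] by simp
qed

lemma connected_jump_frontier:
  assumes "connected S" "x \<in> S" "y \<in> S" "(x \<in> \<Omega>) \<noteq> (y \<in> \<Omega>)"
  obtains w where "w \<in> S" "w \<in> frontier \<Omega>"
  using connected_Int_frontier[of S \<Omega>] assms by blast

text \<open>The vertical segment from \<open>p\<close> to its translate is connected and changes
  sides, and its point at height \<open>u\<close> is at distance \<open>2 * sqrt u\<close> from
  \<open>p\<close>.\<close>

lemma vertical_jump_near_frontier:
  assumes "p \<in> vertical_jump \<Omega> s" "0 \<le> s"
  obtains x where "x \<in> frontier \<Omega>" "dist x p \<le> 2 * s"
proof -
  have mem: "p \<in> (\<lambda>u. vshift u p) ` {0..s\<^sup>2}" "vshift (s\<^sup>2) p \<in> (\<lambda>u. vshift u p) ` {0..s\<^sup>2}"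
    by (auto intro: image_eqI[of _ _ 0])
  obtain x where "x \<in> (\<lambda>u. vshift u p) ` {0..s\<^sup>2}" "x \<in> frontier \<Omega>"
    using connected_jump_frontier[OF connected_vshift_segment mem] assms(1)
    by (auto simp: vertical_jump_def)
  moreover from this obtain u where "0 \<le> u" "u \<le> s\<^sup>2" "x = vshift u p" by auto
  moreover from this have "sqrt \<bar>u\<bar> \<le> s"
    using assms(2) by (auto intro: real_le_lsqrt)
  ultimately show ?thesis
    using that[of x] by (simp add: dist_vshift_self)
qed

text \<open>Moving horizontally away from the plane for time \<open>s\<close> leads, from both ends of the vertical
  segment, into a region without frontier points; so one of the two paths hits the frontier, and it
  does so after a time bounded by the distance of the hitting point from the plane.\<close>

lemma vertical_jump_exit_aux:
  assumes ab: "a\<^sup>2 + b\<^sup>2 = 1" and s: "0 < s" and p: "p \<in> vertical_jump \<Omega> s"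
    and pos: "0 < line_dist a b c p"
    and flat: "\<And>x. x \<in> frontier \<Omega> \<Longrightarrow> dist p x \<le> 3 * s \<Longrightarrow> \<bar>line_dist a b c x\<bar> < s"
  shows "\<exists>x\<in>frontier \<Omega>. dist p x \<le> 3 * s \<and> 0 < \<bar>line_dist a b c x\<bar> \<and>
    (dist p x \<le> \<bar>line_dist a b c x\<bar> \<or> dist (vshift (s\<^sup>2) p) x \<le> \<bar>line_dist a b c x\<bar>)"
proof -
  define h where "h \<tau> = hshift (\<tau> * a) (\<tau> * b)" for \<tau>
  have h0: "h 0 w = w" for w
    by (cases w) (simp add: h_def hshift_def)
  have dist_h: "dist (h \<tau> w) w = \<tau>" if "0 \<le> \<tau>" for \<tau> w
  proof -
    have "dist (h \<tau> w) w = sqrt (\<tau>\<^sup>2 * (a\<^sup>2 + b\<^sup>2))"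
      by (simp only: h_def dist_hshift_self power_mult_distrib distrib_left)
    then show ?thesis using that by (simp add: ab)
  qed
  have dist_v: "dist (vshift u w) w \<le> 2 * s" if "0 \<le> u" "u \<le> s\<^sup>2" for u w
  proof -
    have "sqrt \<bar>u\<bar> \<le> s" using that s by (auto intro: real_le_lsqrt)
    then show ?thesis by (simp add: dist_vshift_self)
  qed
  \<comment> \<open>Points of the vertical segment over \<open>h s p\<close> have line distance
    above \<open>s\<close> but lie within \<open>s + 2 * s\<close> of \<open>p\<close>; by
    \<open>flat\<close> none of them is a frontier point.\<close>
  have top: "h s p \<in> \<Omega> \<longleftrightarrow> vshift (s\<^sup>2) (h s p) \<in> \<Omega>"
  proof (rule ccontr)
    assume neq: "\<not> ?thesis"
    have mem: "h s p \<in> (\<lambda>u. vshift u (h s p)) ` {0..s\<^sup>2}"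
      "vshift (s\<^sup>2) (h s p) \<in> (\<lambda>u. vshift u (h s p)) ` {0..s\<^sup>2}"
      by (auto intro: image_eqI[of _ _ 0])
    obtain x where x: "x \<in> (\<lambda>u. vshift u (h s p)) ` {0..s\<^sup>2}" "x \<in> frontier \<Omega>"
      using connected_jump_frontier[OF connected_vshift_segment mem] neq by blast
    then obtain u where u: "0 \<le> u" "u \<le> s\<^sup>2" "x = vshift u (h s p)" by auto
    have "dist p x \<le> dist p (h s p) + dist x (h s p)"
      by (metis dist_commute dist_triangle)
    also have "\<dots> \<le> 3 * s"
      using dist_h[of s p] dist_v[of u "h s p"] s u by (simp add: dist_commute)
    finally have "\<bar>line_dist a b c x\<bar> < s"
      by (rule flat[OF x(2)])
    then show False
      using pos s unfolding u h_def by (simp add: line_dist_hshift[OF ab])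
  qed
  have hit: "\<exists>x\<in>frontier \<Omega>. dist p x \<le> 3 * s \<and> 0 < \<bar>line_dist a b c x\<bar> \<and> dist w x \<le> \<bar>line_dist a b c x\<bar>"
    if w: "w \<in> {p, vshift (s\<^sup>2) p}" and neq: "(w \<in> \<Omega>) \<noteq> (h s w \<in> \<Omega>)" for w
  proof -
    have mem: "w \<in> (\<lambda>\<tau>. h \<tau> w) ` {0..s}" "h s w \<in> (\<lambda>\<tau>. h \<tau> w) ` {0..s}"
      using s by (auto intro!: image_eqI[of _ _ 0] simp: h0)
    have con: "connected ((\<lambda>\<tau>. h \<tau> w) ` {0..s})"
      unfolding h_def by (rule connected_hshift_segment)
    obtain x where x: "x \<in> (\<lambda>\<tau>. h \<tau> w) ` {0..s}" "x \<in> frontier \<Omega>"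
      using connected_jump_frontier[OF con mem neq] by blast
    then obtain \<tau> where \<tau>: "0 \<le> \<tau>" "\<tau> \<le> s" "x = h \<tau> w" by auto
    \<comment> \<open>Both admissible \<open>w\<close> have the line distance of \<open>p\<close>,
      so at \<open>x\<close> it exceeds the travelled distance \<tau> by a positive amount.\<close>
    have ld: "line_dist a b c x = line_dist a b c p + \<tau>"
      using w unfolding \<tau> h_def by (auto simp: line_dist_hshift[OF ab])
    have dw: "dist w x = \<tau>"
      using dist_h[of \<tau> w] \<tau> by (simp add: dist_commute)
    have "dist p w \<le> 2 * s"
      using w s dist_v[of "s\<^sup>2" p] by (auto simp: dist_commute)
    then have "dist p x \<le> 3 * s"
      using dist_triangle[of p x w] dw \<tau> by simp
    then show ?thesis
      using x(2) ld dw pos \<tau> by (intro bexI[of _ x]) auto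
  qed
  \<comment> \<open>The two horizontal paths end at the two ends of one vertical segment. These are
    on the same side by \<open>top\<close>, while the starting points are not, so one path changes
    sides.\<close>
  have "h s (vshift (s\<^sup>2) p) = vshift (s\<^sup>2) (h s p)"
    by (simp add: h_def hshift_vshift)
  then have "(p \<in> \<Omega>) \<noteq> (h s p \<in> \<Omega>) \<or> (vshift (s\<^sup>2) p \<in> \<Omega>) \<noteq> (h s (vshift (s\<^sup>2) p) \<in> \<Omega>)"
    using p top by (auto simp: vertical_jump_def)
  then show ?thesis
    using hit[of p] hit[of "vshift (s\<^sup>2) p"] by blast
qed

lemma line_dist_uminus: "line_dist (- a) (- b) (- c) p = - line_dist a b c p"
  by (simp add: line_dist_def)

text \<open>On the other side of the plane the normal is reversed, which leaves absolute line
  distances unchanged.\<close>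

lemma vertical_jump_exit:
  assumes ab: "a\<^sup>2 + b\<^sup>2 = 1" and s: "0 < s" and p: "p \<in> vertical_jump \<Omega> s"
    and nz: "line_dist a b c p \<noteq> 0"
    and flat: "\<And>x. x \<in> frontier \<Omega> \<Longrightarrow> dist p x \<le> 3 * s \<Longrightarrow> \<bar>line_dist a b c x\<bar> < s"
  obtains x where "x \<in> frontier \<Omega>" "dist p x \<le> 3 * s" "0 < \<bar>line_dist a b c x\<bar>"
    "dist p x \<le> \<bar>line_dist a b c x\<bar> \<or> dist (vshift (s\<^sup>2) p) x \<le> \<bar>line_dist a b c x\<bar>"
proof (cases "0 < line_dist a b c p")
  case True
  then show ?thesis
    using vertical_jump_exit_aux[OF ab s p _ flat] that by blast
next
  case False
  then have "0 < line_dist (- a) (- b) (- c) p"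
    using nz by (simp add: line_dist_uminus)
  then show ?thesis
    using vertical_jump_exit_aux[of "- a" "- b" s p \<Omega> "- c"] ab s p flat that
    unfolding line_dist_uminus abs_minus_cancel by auto
qed

section \<open>A kernel for Fubini and the volume of jump points in small balls\<close>

text \<open>The weight balances two integrations. Over \<open>p\<close>, a ball of volume of order
  \<open>d ^ 4\<close> divided by \<open>d ^ 3\<close> leaves the line distance \<open>d\<close>, as
  in the beta number; over \<open>y\<close> near a hitting point, regularity gives mass of order
  \<open>d ^ 3\<close> and hence a constant lower bound.\<close>

definition exit_kernel :: "real \<Rightarrow> real \<Rightarrow> real \<Rightarrow> heis \<Rightarrow> heis \<Rightarrow> ennreal" where
  "exit_kernel a b c p y =
    ennreal (1 / \<bar>line_dist a b c y\<bar> ^ 3) * indicator {p. dist p y < 3 * \<bar>line_dist a b c y\<bar>} p"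

lemma measurable_exit_kernel [measurable (raw)]:
  assumes [measurable]: "f \<in> M \<rightarrow>\<^sub>M borel" "g \<in> M \<rightarrow>\<^sub>M borel"
  shows "(\<lambda>w. exit_kernel a b c (f w) (g w)) \<in> borel_measurable M"
  unfolding exit_kernel_def indicator_def mem_Collect_eq by measurable

text \<open>The volume bound for the ball of radius \<open>3 * d\<close> gives
  \<open>162 = 2 * 3 ^ 4\<close>. For \<open>d = 0\<close> the convention \<open>1 / 0 = 0\<close>
  makes both sides vanish.\<close>

lemma nn_integral_exit_kernel_vshift_le:
  "(\<integral>\<^sup>+p. exit_kernel a b c (vshift u p) y \<partial>heis_lborel) \<le> ennreal (162 * \<bar>line_dist a b c y\<bar>)"
proof -
  define d where "d = \<bar>line_dist a b c y\<bar>"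
  have d: "0 \<le> d" by (simp add: d_def)
  have "(\<integral>\<^sup>+p. exit_kernel a b c (vshift u p) y \<partial>heis_lborel) =
      (\<integral>\<^sup>+p. ennreal (1 / d ^ 3) * indicator (ball (vshift (- u) y) (3 * d)) p \<partial>heis_lborel)"
    unfolding vimage_vshift_ball[symmetric] d_def
    by (intro nn_integral_cong) (auto simp: exit_kernel_def indicator_def dist_commute[of y])
  also have "\<dots> = ennreal (1 / d ^ 3) * emeasure heis_lborel (ball (vshift (- u) y) (3 * d))"
    by (intro nn_integral_cmult_indicator) simp
  also have "\<dots> \<le> ennreal (1 / d ^ 3) * ennreal (2 * (3 * d) ^ 4)"
    by (intro mult_left_mono emeasure_ball_le) simp
  also have "\<dots> = ennreal (1 / d ^ 3 * (2 * (3 * d) ^ 4))"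
    using d by (intro ennreal_mult[symmetric]) auto
  also have "1 / d ^ 3 * (2 * (3 * d) ^ 4) = 162 * d"
    by (simp add: power_mult_distrib power3_eq_cube power4_eq_xxxx)
  finally show ?thesis by (simp add: d_def)
qed

text \<open>Regularity produces enough frontier near \<open>x\<close> that, by Fubini, no covering argument is
  needed to measure the set of points \<open>w\<close>.\<close>

lemma exit_kernel_ge:
  assumes reg: "three_regular A E" and x: "x \<in> E" and ab: "a\<^sup>2 + b\<^sup>2 = 1"
    and nz: "0 < \<bar>line_dist a b c x\<bar>" and diam: "ennreal \<bar>line_dist a b c x\<bar> \<le> ediam E"
    and w: "dist w x \<le> \<bar>line_dist a b c x\<bar>"
    and sub: "ball x (\<bar>line_dist a b c x\<bar> / 2) \<subseteq> B"
  shows "ennreal (1 / (27 * A)) \<le> (\<integral>\<^sup>+y. exit_kernel a b c w y * indicator B y \<partial>surface_measure E)"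
proof -
  define d where "d = \<bar>line_dist a b c x\<bar>"
  have d: "0 < d" using nz by (simp add: d_def)
  have A: "1 \<le> A" using reg by (simp add: three_regular_def)
  have "ennreal (d / 2) \<le> ennreal d"
    using d by (intro ennreal_leI) simp
  also have "\<dots> \<le> ediam E"
    using diam by (simp add: d_def)
  finally have mass: "ennreal ((d / 2) ^ 3 / A) \<le> emeasure (surface_measure E) (ball x (d / 2))"
    using d by (intro three_regular_surface_ball[OF reg x]) auto
  \<comment> \<open>The line distance on \<open>ball x (d / 2)\<close> is below
    \<open>3 / 2 * d\<close>, so \<open>8 / (27 * d ^ 3)\<close> bounds the weight there from
    below.\<close>
  have "1 / (27 * A) = 8 / (27 * d ^ 3) * ((d / 2) ^ 3 / A)"
    using d A by (simp add: field_simps)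
  then have "ennreal (1 / (27 * A)) = ennreal (8 / (27 * d ^ 3)) * ennreal ((d / 2) ^ 3 / A)"
    using d A by (simp only: ennreal_mult[symmetric]) (simp add: ennreal_mult[symmetric])
  also have "\<dots> \<le> ennreal (8 / (27 * d ^ 3)) * emeasure (surface_measure E) (ball x (d / 2))"
    by (intro mult_left_mono mass) simp
  also have "\<dots> = (\<integral>\<^sup>+y. ennreal (8 / (27 * d ^ 3)) * indicator (ball x (d / 2)) y \<partial>surface_measure E)"
    by (intro nn_integral_cmult_indicator[symmetric]) simp
  also have "\<dots> \<le> (\<integral>\<^sup>+y. exit_kernel a b c w y * indicator B y \<partial>surface_measure E)"
  proof (intro nn_integral_mono)
    fix y
    show "ennreal (8 / (27 * d ^ 3)) * indicator (ball x (d / 2)) y \<le> exit_kernel a b c w y * indicator B y"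
    proof (cases "y \<in> ball x (d / 2)")
      case True
      define e where "e = \<bar>line_dist a b c y\<bar>"
      have xy: "dist x y < d / 2" using True by simp
      have e: "d / 2 < e" "e < 3 / 2 * d"
        using line_dist_lipschitz[OF ab, of c x y] xy unfolding d_def e_def by linarith+
      have "e ^ 3 \<le> (3 / 2 * d) ^ 3"
        using e d by (intro power_mono) auto
      then have "8 / (27 * d ^ 3) \<le> 1 / e ^ 3"
        using d e by (simp add: field_simps power3_eq_cube)
      \<comment> \<open>The distance is below \<open>d + d / 2 = 3 * (d / 2)\<close>, and
        \<open>d / 2 < e\<close>. This is the origin of the factor 3 in
        \<open>exit_kernel\<close>.\<close>
      moreover have "dist w y < 3 * e"
        using dist_triangle[of w y x] w xy e unfolding d_def[symmetric] by linarith
      ultimately show ?thesis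
        using True sub unfolding exit_kernel_def d_def[symmetric] e_def[symmetric]
        by (auto simp: indicator_def subset_iff intro!: ennreal_leI)
    qed simp
  qed
  finally show ?thesis .
qed

text \<open>If a frontier point within \<open>6 * s\<close> of \<open>q\<close> has line distance at
  least \<open>s\<close>, regularity around it makes the right side at least the volume bound of the
  whole ball. Otherwise \<open>vertical_jump_exit\<close> applies to every jump point off the plane,
  and Fubini with \<open>exit_kernel\<close> gives the constant
  \<open>8748 = 27 * (162 + 162)\<close>.\<close>

lemma emeasure_vertical_jump_ball_le:
  assumes \<Omega>: "open \<Omega>" and reg: "three_regular A (frontier \<Omega>)" and ab: "a\<^sup>2 + b\<^sup>2 = 1"
    and s: "0 < s" "ennreal s \<le> ediam (frontier \<Omega>)"
  shows "emeasure heis_lborel (vertical_jump \<Omega> s \<inter> ball q (3 * s)) \<le>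
    ennreal (8748 * A) *
      (\<integral>\<^sup>+y. ennreal \<bar>line_dist a b c y\<bar> * indicator (ball q (7 * s)) y \<partial>surface_measure (frontier \<Omega>))"
proof -
  let ?E = "frontier \<Omega>" and ?\<sigma> = "surface_measure (frontier \<Omega>)" and ?B = "ball q (7 * s)"
  define ld where "ld y = \<bar>line_dist a b c y\<bar>" for y
  have ld_meas [measurable]: "ld \<in> borel_measurable borel"
    unfolding ld_def by measurable
  have A: "1 \<le> A" using reg by (simp add: three_regular_def)
  note [measurable] = vertical_jump_borel[OF \<Omega>, of s]
  have [measurable]: "?B \<in> sets borel" by simp
  show ?thesis
  proof (cases "\<exists>x\<in>?E. dist q x < 6 * s \<and> s \<le> ld x")
    case True
    then obtain x where x: "x \<in> ?E" "dist q x < 6 * s" "s \<le> ld x" by blast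
    have "ennreal (s / 2) \<le> ennreal s"
      using s by (intro ennreal_leI) simp
    also note s(2)
    finally have mass: "ennreal ((s / 2) ^ 3 / A) \<le> emeasure ?\<sigma> (ball x (s / 2))"
      using s by (intro three_regular_surface_ball[OF reg x(1)]) auto
    have "emeasure heis_lborel (vertical_jump \<Omega> s \<inter> ball q (3 * s)) \<le> emeasure heis_lborel (ball q (3 * s))"
      by (intro emeasure_mono) auto
    also have "\<dots> \<le> ennreal (2 * (3 * s) ^ 4)"
      by (rule emeasure_ball_le)
    \<comment> \<open>Here \<open>A\<close> cancels, and \<open>2 * 3 ^ 4 = 162\<close> is below
      \<open>8748 / 16\<close>.\<close>
    also have "\<dots> \<le> ennreal (8748 * A * (s / 2 * ((s / 2) ^ 3 / A)))"
      using A s by (intro ennreal_leI) (simp add: power_mult_distrib power3_eq_cube power4_eq_xxxx field_simps)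
    also have "\<dots> = ennreal (8748 * A) * (ennreal (s / 2) * ennreal ((s / 2) ^ 3 / A))"
    proof -
      have "0 \<le> 8748 * A" "0 \<le> s / 2" "0 \<le> (s / 2) ^ 3 / A"
        using A s by auto
      then show ?thesis
        by (simp only: ennreal_mult mult_nonneg_nonneg)
    qed
    also have "\<dots> \<le> ennreal (8748 * A) * (ennreal (s / 2) * emeasure ?\<sigma> (ball x (s / 2)))"
      by (intro mult_left_mono mass) auto
    also have "ennreal (s / 2) * emeasure ?\<sigma> (ball x (s / 2)) =
        (\<integral>\<^sup>+y. ennreal (s / 2) * indicator (ball x (s / 2)) y \<partial>?\<sigma>)"
      by (intro nn_integral_cmult_indicator[symmetric]) simp
    also have "\<dots> \<le> (\<integral>\<^sup>+y. ennreal (ld y) * indicator ?B y \<partial>?\<sigma>)"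
    proof (intro nn_integral_mono)
      fix y
      show "ennreal (s / 2) * indicator (ball x (s / 2)) y \<le> ennreal (ld y) * indicator ?B y"
      proof (cases "y \<in> ball x (s / 2)")
        case True
        then have xy: "dist x y < s / 2" by simp
        have "s / 2 \<le> ld y"
          using line_dist_lipschitz[OF ab, of c x y] xy x(3) unfolding ld_def by linarith
        moreover have "dist q y < 7 * s"
          using dist_triangle[of q y x] xy x(2) s by linarith
        ultimately show ?thesis
          using True by (auto intro: ennreal_leI)
      qed simp
    qed
    finally show ?thesis
      by (simp add: ld_def mult_left_mono)
  next
    case False
    then have flat: "ld x < s" if "x \<in> ?E" "dist q x < 6 * s" for x
      using that by (meson not_le)
    interpret L: sigma_finite_measure heis_lborel
      by (rule sigma_finite_heis_lborel)
    interpret S: sigma_finite_measure ?\<sigma>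
      by (rule sigma_finite_surface_measure[OF reg s])
    interpret LS: pair_sigma_finite heis_lborel ?\<sigma> ..
    let ?k = "exit_kernel a b c" and ?v = "vshift (s\<^sup>2)"
    \<comment> \<open>The path may start at \<open>p\<close> or at its translate, so both kernels
      are added; \<open>27 * A\<close> inverts the bound of \<open>exit_kernel_ge\<close>.\<close>
    have pointwise: "indicator (vertical_jump \<Omega> s \<inter> ball q (3 * s)) p \<le>
        ennreal (27 * A) * (\<integral>\<^sup>+y. (?k p y + ?k (?v p) y) * indicator ?B y \<partial>?\<sigma>)"
      if nz: "line_dist a b c p \<noteq> 0" for p
    proof (cases "p \<in> vertical_jump \<Omega> s \<inter> ball q (3 * s)")
      case True
      then have jump: "p \<in> vertical_jump \<Omega> s" and qp: "dist q p < 3 * s" by auto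
      have flat': "\<bar>line_dist a b c x\<bar> < s" if "x \<in> ?E" "dist p x \<le> 3 * s" for x
        using flat[OF that(1)] that(2) dist_triangle[of q x p] qp by (simp add: ld_def)
      obtain x where x: "x \<in> ?E" "dist p x \<le> 3 * s" "0 < \<bar>line_dist a b c x\<bar>"
        "dist p x \<le> \<bar>line_dist a b c x\<bar> \<or> dist (?v p) x \<le> \<bar>line_dist a b c x\<bar>"
        using vertical_jump_exit[OF ab s(1) jump nz flat'] by blast
      have ldx: "\<bar>line_dist a b c x\<bar> < s"
        using flat' x by blast
      then have "ennreal \<bar>line_dist a b c x\<bar> \<le> ennreal s"
        by (intro ennreal_leI) simp
      then have diam: "ennreal \<bar>line_dist a b c x\<bar> \<le> ediam ?E"
        using s(2) by (rule order_trans)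
      \<comment> \<open>From \<open>q\<close> to \<open>p\<close> to \<open>x\<close> to
        \<open>y\<close>: \<open>3 * s + 3 * s + s / 2\<close> is below
        \<open>7 * s\<close>.\<close>
      have sub: "ball x (\<bar>line_dist a b c x\<bar> / 2) \<subseteq> ?B"
      proof
        fix y assume "y \<in> ball x (\<bar>line_dist a b c x\<bar> / 2)"
        then show "y \<in> ?B"
          using dist_triangle[of q y x] dist_triangle[of q x p] qp x(2) ldx by simp
      qed
      obtain w where w: "w = p \<or> w = ?v p" "dist w x \<le> \<bar>line_dist a b c x\<bar>"
        using x(4) by blast
      have "ennreal (1 / (27 * A)) \<le> (\<integral>\<^sup>+y. ?k w y * indicator ?B y \<partial>?\<sigma>)"
        by (rule exit_kernel_ge[OF reg x(1) ab x(3) diam w(2) sub])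
      also have "\<dots> \<le> (\<integral>\<^sup>+y. (?k p y + ?k (?v p) y) * indicator ?B y \<partial>?\<sigma>)"
        using w(1) by (intro nn_integral_mono mult_right_mono) auto
      finally have "ennreal (27 * A) * ennreal (1 / (27 * A)) \<le>
          ennreal (27 * A) * (\<integral>\<^sup>+y. (?k p y + ?k (?v p) y) * indicator ?B y \<partial>?\<sigma>)"
        by (intro mult_left_mono) auto
      moreover have "ennreal (27 * A) * ennreal (1 / (27 * A)) = 1"
        using A by (simp add: ennreal_mult[symmetric])
      ultimately show ?thesis
        using True by simp
    qed simp
    \<comment> \<open>The pointwise bound is available off the plane, which is a null set.\<close>
    have "AE p in heis_lborel. line_dist a b c p \<noteq> 0"
    proof (rule AE_I)
      show "{p \<in> space heis_lborel. \<not> line_dist a b c p \<noteq> 0} \<subseteq> {p. line_dist a b c p = 0}"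
        by auto
      show "{p. line_dist a b c p = 0} \<in> sets heis_lborel"
        by (auto intro: borel_closed closed_Collect_eq continuous_on_line_dist)
    qed (rule null_line_dist[OF ab])
    then have "(\<integral>\<^sup>+p. indicator (vertical_jump \<Omega> s \<inter> ball q (3 * s)) p \<partial>heis_lborel) \<le>
        (\<integral>\<^sup>+p. ennreal (27 * A) * (\<integral>\<^sup>+y. (?k p y + ?k (?v p) y) * indicator ?B y \<partial>?\<sigma>) \<partial>heis_lborel)"
      using pointwise by (intro nn_integral_mono_AE) auto
    also have "\<dots> = ennreal (27 * A) *
        (\<integral>\<^sup>+p. (\<integral>\<^sup>+y. (?k p y + ?k (?v p) y) * indicator ?B y \<partial>?\<sigma>) \<partial>heis_lborel)"
      by (intro nn_integral_cmult) measurable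
    also have "(\<integral>\<^sup>+p. (\<integral>\<^sup>+y. (?k p y + ?k (?v p) y) * indicator ?B y \<partial>?\<sigma>) \<partial>heis_lborel) =
        (\<integral>\<^sup>+y. (\<integral>\<^sup>+p. (?k p y + ?k (?v p) y) * indicator ?B y \<partial>heis_lborel) \<partial>?\<sigma>)"
      by (intro LS.Fubini'[symmetric]) measurable
    also have "\<dots> \<le> (\<integral>\<^sup>+y. ennreal 324 * (ennreal (ld y) * indicator ?B y) \<partial>?\<sigma>)"
    proof (intro nn_integral_mono)
      fix y
      have "(\<integral>\<^sup>+p. (?k p y + ?k (?v p) y) * indicator ?B y \<partial>heis_lborel) =
          ((\<integral>\<^sup>+p. ?k (vshift 0 p) y \<partial>heis_lborel) + (\<integral>\<^sup>+p. ?k (?v p) y \<partial>heis_lborel)) * indicator ?B y"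
        by (simp add: nn_integral_multc nn_integral_add)
      also have "\<dots> \<le> (ennreal (162 * ld y) + ennreal (162 * ld y)) * indicator ?B y"
        unfolding ld_def by (intro mult_right_mono add_mono nn_integral_exit_kernel_vshift_le) auto
      also have "ennreal (162 * ld y) + ennreal (162 * ld y) = ennreal 324 * ennreal (ld y)"
        by (simp add: ld_def ennreal_mult flip: distrib_right)
      finally show "(\<integral>\<^sup>+p. (?k p y + ?k (?v p) y) * indicator ?B y \<partial>heis_lborel) \<le>
          ennreal 324 * (ennreal (ld y) * indicator ?B y)"
        by (simp add: mult.assoc)
    qed
    also have "\<dots> = ennreal 324 * (\<integral>\<^sup>+y. ennreal (ld y) * indicator ?B y \<partial>?\<sigma>)"
      by (intro nn_integral_cmult) measurable
    finally have "(\<integral>\<^sup>+p. indicator (vertical_jump \<Omega> s \<inter> ball q (3 * s)) p \<partial>heis_lborel) \<le>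
        ennreal (27 * A) * (ennreal 324 * (\<integral>\<^sup>+y. ennreal (ld y) * indicator ?B y \<partial>?\<sigma>))"
      by (simp add: mult_left_mono)
    also have "\<dots> = ennreal (8748 * A) * (\<integral>\<^sup>+y. ennreal (ld y) * indicator ?B y \<partial>?\<sigma>)"
    proof -
      have "ennreal (27 * A) * ennreal 324 = ennreal (8748 * A)"
        using A by (subst ennreal_mult[symmetric]) auto
      then show ?thesis
        by (simp only: mult.assoc[symmetric])
    qed
    finally show ?thesis
      by (simp add: ld_def)
  qed
qed

section \<open>Beta numbers and the vertical perimeter\<close>

lemma le_mult_INF_ennreal:
  fixes X :: ennreal
  assumes c: "0 < c" and le: "\<And>i. i \<in> I \<Longrightarrow> X \<le> ennreal c * f i"
  shows "X \<le> ennreal c * (INF i\<in>I. f i)"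
proof -
  have inv: "ennreal (1 / c) * (ennreal c * Y) = Y" "ennreal c * (ennreal (1 / c) * Y) = Y" for Y
    using c by (simp_all add: mult.assoc[symmetric] ennreal_mult[symmetric])
  have "ennreal (1 / c) * X \<le> (INF i\<in>I. f i)"
  proof (rule INF_greatest)
    fix i assume "i \<in> I"
    from mult_left_mono[OF le[OF this], of "ennreal (1 / c)"] show "ennreal (1 / c) * X \<le> f i"
      by (simp add: inv)
  qed
  then have "ennreal c * (ennreal (1 / c) * X) \<le> ennreal c * (INF i\<in>I. f i)"
    by (rule mult_left_mono) simp
  then show ?thesis by (simp add: inv)
qed

text \<open>The factor \<open>r ^ 4\<close> undoes both normalisations, by \<open>r ^ 3\<close> and
  by \<open>r\<close>. The remaining integrals are monotone in the ball, which allows centres and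
  radii of beta numbers to be changed.\<close>

lemma scaled_beta_integral:
  fixes h :: "heis \<Rightarrow> real"
  assumes E: "closed E" and h: "h \<in> borel_measurable borel" "\<And>x. 0 \<le> h x" and r: "0 < r"
  shows "ennreal (r ^ 4) * (ennreal (1 / r ^ 3) * (\<integral>\<^sup>+x\<in>ball q r \<inter> E. ennreal (h x / r) \<partial>hausdorff_measure 3)) =
    (\<integral>\<^sup>+x. ennreal (h x) * indicator (ball q r) x \<partial>surface_measure E)"
proof -
  note [measurable] = h(1)
  have ball [measurable]: "ball q r \<in> sets borel" by simp
  have "(\<integral>\<^sup>+x\<in>ball q r \<inter> E. ennreal (h x / r) \<partial>hausdorff_measure 3) =
      (\<integral>\<^sup>+x. ennreal (h x / r) * indicator (ball q r) x \<partial>surface_measure E)"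
    by (subst nn_integral_surface_measure[OF E]) (simp_all add: indicator_inter_arith mult.assoc)
  also have "\<dots> = (\<integral>\<^sup>+x. ennreal (1 / r) * (ennreal (h x) * indicator (ball q r) x) \<partial>surface_measure E)"
    using r h(2) by (intro nn_integral_cong) (simp add: mult.assoc[symmetric] ennreal_mult[symmetric])
  also have "\<dots> = ennreal (1 / r) * (\<integral>\<^sup>+x. ennreal (h x) * indicator (ball q r) x \<partial>surface_measure E)"
    by (intro nn_integral_cmult) measurable
  finally have eq: "(\<integral>\<^sup>+x\<in>ball q r \<inter> E. ennreal (h x / r) \<partial>hausdorff_measure 3) = \<dots>" .
  have "ennreal (r ^ 4) * (ennreal (1 / r ^ 3) * ennreal (1 / r)) = 1"
    using r by (simp add: ennreal_mult[symmetric] power3_eq_cube power4_eq_xxxx)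
  then show ?thesis
    unfolding eq by (simp only: mult.assoc[symmetric] mult_1_left)
qed

lemma le_scaled_beta1:
  assumes E: "closed E" and r: "0 < r" and K: "0 < K"
    and le: "\<And>W z. vertical_subgroup W \<Longrightarrow>
      X \<le> ennreal K * (\<integral>\<^sup>+x. ennreal (infdist x ((*) z ` W)) * indicator (ball q r) x \<partial>surface_measure E)"
  shows "X \<le> ennreal (K * r ^ 4) * beta1 E q r"
  unfolding beta1_def
proof (rule le_mult_INF_ennreal)
  show "0 < K * r ^ 4" using r K by simp
  fix Wz :: "heis set \<times> heis" assume "Wz \<in> {(W, z). vertical_subgroup W}"
  then obtain W z where W: "Wz = (W, z)" "vertical_subgroup W" by auto
  have "(\<lambda>x. infdist x ((*) z ` W)) \<in> borel_measurable borel"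
    by (intro borel_measurable_continuous_onI continuous_intros)
  from scaled_beta_integral[OF E this infdist_nonneg r, of q] show
    "X \<le> ennreal (K * r ^ 4) * (case Wz of (W, z) \<Rightarrow> ennreal (1 / r ^ 3) *
      (\<integral>\<^sup>+x\<in>ball q r \<inter> E. ennreal (infdist x ((*) z ` W) / r) \<partial>hausdorff_measure 3))"
    using le[OF W(2), of z] r K by (simp add: W(1) ennreal_mult mult.assoc)
qed

lemma scaled_beta1_mono:
  assumes E: "closed E" and r: "0 < r" "0 < r'" and sub: "ball q r \<subseteq> ball q' r'"
  shows "ennreal (r ^ 4) * beta1 E q r \<le> ennreal (r' ^ 4) * beta1 E q' r'"
proof -
  have "ennreal (r ^ 4) * beta1 E q r \<le> ennreal (1 * r' ^ 4) * beta1 E q' r'"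
  proof (rule le_scaled_beta1[OF E r(2)])
    fix W z assume W: "vertical_subgroup W"
    have m: "(\<lambda>x. infdist x ((*) z ` W)) \<in> borel_measurable borel"
      by (intro borel_measurable_continuous_onI continuous_intros)
    have "ennreal (r ^ 4) * beta1 E q r \<le> ennreal (r ^ 4) * (ennreal (1 / r ^ 3) *
        (\<integral>\<^sup>+x\<in>ball q r \<inter> E. ennreal (infdist x ((*) z ` W) / r) \<partial>hausdorff_measure 3))"
      unfolding beta1_def using W by (intro mult_left_mono INF_lower2[of "(W, z)"]) auto
    also have "\<dots> = (\<integral>\<^sup>+x. ennreal (infdist x ((*) z ` W)) * indicator (ball q r) x \<partial>surface_measure E)"
      by (rule scaled_beta_integral[OF E m infdist_nonneg r(1)])
    also have "\<dots> \<le> (\<integral>\<^sup>+x. ennreal (infdist x ((*) z ` W)) * indicator (ball q' r') x \<partial>surface_measure E)"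
      using sub by (intro nn_integral_mono mult_left_mono) (auto simp: indicator_def)
    finally show "ennreal (r ^ 4) * beta1 E q r \<le>
        ennreal 1 * (\<integral>\<^sup>+x. ennreal (infdist x ((*) z ` W)) * indicator (ball q' r') x \<partial>surface_measure E)"
      by simp
  qed simp
  then show ?thesis by simp
qed

lemma emeasure_vertical_jump_le_beta1:
  assumes \<Omega>: "open \<Omega>" and reg: "three_regular A (frontier \<Omega>)"
    and s: "0 < s" "ennreal s \<le> ediam (frontier \<Omega>)"
    and sub: "ball q (7 * s) \<subseteq> ball q' r" and r: "0 < r"
  shows "emeasure heis_lborel (vertical_jump \<Omega> s \<inter> ball q (3 * s)) \<le>
    ennreal (8748 * A * r ^ 4) * beta1 (frontier \<Omega>) q' r"
proof (rule le_scaled_beta1[OF _ r])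
  show "closed (frontier \<Omega>)" by simp
  show "0 < 8748 * A" using reg by (simp add: three_regular_def)
  fix W z assume W: "vertical_subgroup W"
  obtain a b c where ab: "a\<^sup>2 + b\<^sup>2 = 1" and ld: "\<And>p. infdist p ((*) z ` W) = \<bar>line_dist a b c p\<bar>"
    by (rule infdist_vertical_coset[OF W, where z = z]) (rule that; assumption)
  have "emeasure heis_lborel (vertical_jump \<Omega> s \<inter> ball q (3 * s)) \<le> ennreal (8748 * A) *
      (\<integral>\<^sup>+y. ennreal \<bar>line_dist a b c y\<bar> * indicator (ball q (7 * s)) y \<partial>surface_measure (frontier \<Omega>))"
    by (rule emeasure_vertical_jump_ball_le[OF \<Omega> reg ab s])
  also have "\<dots> \<le> ennreal (8748 * A) *
      (\<integral>\<^sup>+y. ennreal \<bar>line_dist a b c y\<bar> * indicator (ball q' r) y \<partial>surface_measure (frontier \<Omega>))"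
    using sub by (intro nn_integral_mono mult_left_mono) (auto simp: indicator_def)
  finally show "emeasure heis_lborel (vertical_jump \<Omega> s \<inter> ball q (3 * s)) \<le> ennreal (8748 * A) *
      (\<integral>\<^sup>+y. ennreal (infdist y ((*) z ` W)) * indicator (ball q' r) y \<partial>surface_measure (frontier \<Omega>))"
    by (simp add: ld)
qed

text \<open>This avoids the question whether the beta numbers are measurable in centre and radius (without
  measurability \<open>\<integral>\<^sup>+\<close> is only a lower integral): the minorant is constant on the pieces of a countable
  partition, the centre being moved to a countable dense set and the radius to a power of two.\<close>

lemma beta1_measurable_minorant:
  assumes E: "closed E"
  obtains g :: "real \<times> heis \<Rightarrow> ennreal" where "g \<in> borel_measurable (borel \<Otimes>\<^sub>M borel)"
    "\<And>s q. 0 < s \<Longrightarrow> g (s, q) \<le> beta1 E q (18 * s)"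
    "\<And>s q. 0 < s \<Longrightarrow> \<exists>q' r. ball q (7 * s) \<subseteq> ball q' r \<and> 0 < r \<and>
      ennreal (r ^ 4) * beta1 E q' r \<le> ennreal (26 * (16 * s) ^ 4) * g (s, q)"
proof -
  obtain D :: "heis set" where D: "countable D" "UNIV \<subseteq> closure D"
    using separable[of "UNIV :: heis set"] by auto
  then have "D \<noteq> {}" by auto
  define e where "e = from_nat_into D"
  have e: "\<exists>j. dist q (e j) < \<epsilon>" if pos: "0 < \<epsilon>" for q \<epsilon>
  proof -
    have "q \<in> closure D" using D(2) by auto
    then obtain d where "d \<in> D" "dist d q < \<epsilon>"
      using pos unfolding closure_approachable by blast
    then show ?thesis
      by (metis D(1) dist_commute e_def from_nat_into_surj)
  qed
  define k where "k s = \<lceil>log 2 s\<rceil>" for s :: real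
  define \<rho> where "\<rho> i = 2 powr real_of_int i" for i :: int
  define j where "j i q = (LEAST j. dist q (e j) < \<rho> i)" for i q
  \<comment> \<open>The new centre is within \<open>\<rho> (k s)\<close> of \<open>q\<close>, and
    \<open>s \<le> \<rho> (k s) < 2 * s\<close>. Hence
    \<open>7 * s + \<rho> (k s) \<le> 8 * \<rho> (k s)\<close>, so the new ball contains
    \<open>ball q (7 * s)\<close>, and \<open>9 * \<rho> (k s) < 18 * s\<close>, so it lies in
    \<open>ball q (18 * s)\<close>. The factor \<open>1 / 26\<close> pays for the change of radius:
    \<open>(18 / 8) ^ 4 < 26\<close>.\<close>
  define g where "g = (\<lambda>(s, q). ennreal (1 / 26) * beta1 E (e (j (k s) q)) (8 * \<rho> (k s)))"
  have \<rho>: "s \<le> \<rho> (k s)" "\<rho> (k s) < 2 * s" if "0 < s" for s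
  proof -
    have "log 2 s \<le> real_of_int (k s)" "real_of_int (k s) < log 2 s + 1"
      unfolding k_def by linarith+
    then have "2 powr log 2 s \<le> \<rho> (k s)" "\<rho> (k s) < 2 powr (log 2 s + 1)"
      unfolding \<rho>_def by auto
    then show "s \<le> \<rho> (k s)" "\<rho> (k s) < 2 * s"
      using that by (simp_all add: powr_add)
  qed
  have j: "dist q (e (j i q)) < \<rho> i" for i q
    unfolding j_def by (rule LeastI_ex) (rule e, simp add: \<rho>_def)
  have k_meas: "(\<lambda>w. k (fst w)) \<in> borel \<Otimes>\<^sub>M (borel :: heis measure) \<rightarrow>\<^sub>M count_space UNIV"
    unfolding k_def by measurable
  have j_meas: "(\<lambda>w. j i (snd w)) \<in> (borel :: real measure) \<Otimes>\<^sub>M borel \<rightarrow>\<^sub>M count_space UNIV" for i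
    unfolding j_def by measurable
  \<comment> \<open>Only countably many values of \<open>k\<close> and \<open>j\<close> occur, and
    the function is constant once they are fixed; measurability follows whatever
    \<open>beta1\<close> is.\<close>
  have "(\<lambda>w. ennreal (1 / 26) * beta1 E (e (j (k (fst w)) (snd w))) (8 * \<rho> (k (fst w)))) \<in>
      borel_measurable (borel \<Otimes>\<^sub>M borel)"
  proof (rule measurable_compose_countable[OF _ k_meas])
    fix i
    show "(\<lambda>w. ennreal (1 / 26) * beta1 E (e (j i (snd w))) (8 * \<rho> i)) \<in>
        borel_measurable ((borel :: real measure) \<Otimes>\<^sub>M borel)"
      by (rule measurable_compose_countable[OF _ j_meas]) simp
  qed
  then have 1: "g \<in> borel_measurable (borel \<Otimes>\<^sub>M borel)"
    by (simp add: g_def case_prod_beta)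
  have 2: "g (s, q) \<le> beta1 E q (18 * s)" if s: "0 < s" for s q
  proof -
    let ?r = "8 * \<rho> (k s)" and ?q = "e (j (k s) q)"
    have sub: "ball ?q ?r \<subseteq> ball q (18 * s)"
    proof
      fix y assume "y \<in> ball ?q ?r"
      then show "y \<in> ball q (18 * s)"
        using dist_triangle[of q y ?q] j[of q "k s"] \<rho>[OF s] by simp
    qed
    have r: "0 < ?r" using \<rho>[OF s] s by simp
    have "ennreal (?r ^ 4) * beta1 E ?q ?r \<le> ennreal ((18 * s) ^ 4) * beta1 E q (18 * s)"
      using s by (intro scaled_beta1_mono[OF E r _ sub]) simp
    also have "\<dots> \<le> ennreal (26 * ?r ^ 4) * beta1 E q (18 * s)"
    proof (intro mult_right_mono ennreal_leI)
      have "(18 * s) ^ 4 \<le> 26 * (8 * s) ^ 4"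
        using s by (simp add: power_mult_distrib)
      also have "\<dots> \<le> 26 * ?r ^ 4"
        using \<rho>[OF s] s by (intro mult_left_mono power_mono) auto
      finally show "(18 * s) ^ 4 \<le> 26 * ?r ^ 4" .
    qed simp
    finally have "ennreal (1 / (26 * ?r ^ 4)) * (ennreal (?r ^ 4) * beta1 E ?q ?r) \<le>
        ennreal (1 / (26 * ?r ^ 4)) * (ennreal (26 * ?r ^ 4) * beta1 E q (18 * s))"
      by (rule mult_left_mono) simp
    moreover have "ennreal (1 / (26 * ?r ^ 4)) * ennreal (?r ^ 4) = ennreal (1 / 26)"
      using r by (subst ennreal_mult[symmetric]) auto
    moreover have "ennreal (1 / (26 * ?r ^ 4)) * ennreal (26 * ?r ^ 4) = 1"
      using r by (subst ennreal_mult[symmetric]) auto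
    ultimately show ?thesis
      by (simp only: mult.assoc[symmetric] g_def case_prod_conv mult_1_left)
  qed
  have 3: "\<exists>q' r. ball q (7 * s) \<subseteq> ball q' r \<and> 0 < r \<and>
      ennreal (r ^ 4) * beta1 E q' r \<le> ennreal (26 * (16 * s) ^ 4) * g (s, q)" if s: "0 < s" for s q
  proof (intro exI conjI)
    let ?r = "8 * \<rho> (k s)" and ?q = "e (j (k s) q)"
    show "ball q (7 * s) \<subseteq> ball ?q ?r"
    proof
      fix y assume "y \<in> ball q (7 * s)"
      then show "y \<in> ball ?q ?r"
        using dist_triangle[of ?q y q] j[of q "k s"] \<rho>[OF s] by (simp add: dist_commute)
    qed
    show "0 < ?r" using \<rho>[OF s] s by simp
    have "ennreal (?r ^ 4) * beta1 E ?q ?r \<le> ennreal ((16 * s) ^ 4) * beta1 E ?q ?r"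
      using \<rho>[OF s] s by (intro mult_right_mono ennreal_leI power_mono) auto
    also have "\<dots> = ennreal (26 * (16 * s) ^ 4) * g (s, q)"
    proof -
      have "ennreal (26 * (16 * s) ^ 4) * ennreal (1 / 26) = ennreal ((16 * s) ^ 4)"
        using s by (subst ennreal_mult[symmetric]) auto
      then show ?thesis
        by (simp only: mult.assoc[symmetric] g_def case_prod_conv)
    qed
    finally show "ennreal (?r ^ 4) * beta1 E ?q ?r \<le> ennreal (26 * (16 * s) ^ 4) * g (s, q)" .
  qed
  show ?thesis
    by (rule that[OF 1 2 3])
qed

section \<open>Bounds for the vertical difference at one scale\<close>

text \<open>A jump point \<open>p\<close> has a frontier point \<open>x\<close> within
  \<open>2 * s\<close>, and \<open>ball x s\<close> has mass at least \<open>s ^ 3 / A\<close> and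
  lies within \<open>3 * s\<close> of \<open>p\<close>. So the indicator of the jump points is at
  most \<open>A / s ^ 3\<close> times an integral over the frontier, and Fubini applies. The points
  \<open>q\<close> stay within \<open>R + 3 * s \<le> 4 * R\<close> of \<open>p0\<close>.\<close>

lemma vertical_diff_le_integral:
  assumes \<Omega>: "open \<Omega>" and reg: "three_regular A (frontier \<Omega>)"
    and s: "0 < s" "s \<le> R" "ennreal s \<le> ediam (frontier \<Omega>)"
  shows "vertical_diff \<Omega> (ball p0 R) s \<le> ennreal (A / s ^ 3) *
    (\<integral>\<^sup>+q. emeasure heis_lborel (vertical_jump \<Omega> s \<inter> ball q (3 * s)) * indicator (ball p0 (4 * R)) q
      \<partial>surface_measure (frontier \<Omega>))"
proof -
  let ?E = "frontier \<Omega>" and ?\<sigma> = "surface_measure (frontier \<Omega>)" and ?J = "vertical_jump \<Omega> s"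
  interpret L: sigma_finite_measure heis_lborel
    by (rule sigma_finite_heis_lborel)
  interpret S: sigma_finite_measure ?\<sigma>
    by (rule sigma_finite_surface_measure[OF reg s(1,3)])
  interpret LS: pair_sigma_finite heis_lborel ?\<sigma> ..
  have A: "1 \<le> A" using reg by (simp add: three_regular_def)
  note [measurable] = vertical_jump_borel[OF \<Omega>, of s]
  have [measurable]: "ball p0 (4 * R) \<in> sets borel" "ball p0 R \<in> sets borel" by simp_all
  define F :: "heis \<Rightarrow> heis \<Rightarrow> ennreal" where
    "F p q = indicator ?J p * indicator {w. dist p w < 3 * s} q * indicator (ball p0 (4 * R)) q" for p q
  have F_meas [measurable]: "(\<lambda>w. F (fst w) (snd w)) \<in> borel_measurable (heis_lborel \<Otimes>\<^sub>M ?\<sigma>)"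
    unfolding F_def indicator_def mem_Collect_eq by measurable
  have pointwise: "indicator (?J \<inter> ball p0 R) p \<le> ennreal (A / s ^ 3) * (\<integral>\<^sup>+q. F p q \<partial>?\<sigma>)" for p
  proof (cases "p \<in> ?J \<inter> ball p0 R")
    case True
    then obtain x where x: "x \<in> ?E" "dist x p \<le> 2 * s"
      using vertical_jump_near_frontier[of p \<Omega> s] s by auto
    have pR: "dist p0 p < R" using True by simp
    have "ennreal (A / s ^ 3) * ennreal (s ^ 3 / A) = 1"
      using A s by (subst ennreal_mult[symmetric]) auto
    then have "1 \<le> ennreal (A / s ^ 3) * emeasure ?\<sigma> (ball x s)"
      using three_regular_surface_ball(1)[OF reg x(1) s(1,3)] by (metis mult_left_mono zero_le)
    also have "emeasure ?\<sigma> (ball x s) = (\<integral>\<^sup>+q. indicator (ball x s) q \<partial>?\<sigma>)"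
      by simp
    also have "\<dots> \<le> (\<integral>\<^sup>+q. F p q \<partial>?\<sigma>)"
    proof (intro nn_integral_mono)
      fix q
      show "indicator (ball x s) q \<le> F p q"
      proof (cases "q \<in> ball x s")
        case q: True
        have 1: "dist p q < 3 * s"
          using dist_triangle[of p q x] q x(2) by (simp add: dist_commute)
        then have "dist p0 q < 4 * R"
          using dist_triangle[of p0 q p] pR s(2) by simp
        then show ?thesis
          using 1 True q by (simp add: F_def)
      qed simp
    qed
    finally show ?thesis
      using True by (simp add: mult_left_mono)
  qed simp
  have "vertical_diff \<Omega> (ball p0 R) s = (\<integral>\<^sup>+p. indicator (?J \<inter> ball p0 R) p \<partial>heis_lborel)"
    by (simp add: vertical_diff_eq[OF \<Omega>])
  also have "\<dots> \<le> (\<integral>\<^sup>+p. ennreal (A / s ^ 3) * (\<integral>\<^sup>+q. F p q \<partial>?\<sigma>) \<partial>heis_lborel)"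
    by (intro nn_integral_mono pointwise)
  also have "\<dots> = ennreal (A / s ^ 3) * (\<integral>\<^sup>+p. (\<integral>\<^sup>+q. F p q \<partial>?\<sigma>) \<partial>heis_lborel)"
    by (intro nn_integral_cmult S.borel_measurable_nn_integral) (use F_meas in \<open>simp add: case_prod_beta\<close>)
  also have "(\<integral>\<^sup>+p. (\<integral>\<^sup>+q. F p q \<partial>?\<sigma>) \<partial>heis_lborel) = (\<integral>\<^sup>+q. (\<integral>\<^sup>+p. F p q \<partial>heis_lborel) \<partial>?\<sigma>)"
    by (intro LS.Fubini'[symmetric]) (use F_meas in \<open>simp add: case_prod_beta\<close>)
  also have "\<dots> = (\<integral>\<^sup>+q. emeasure heis_lborel (?J \<inter> ball q (3 * s)) * indicator (ball p0 (4 * R)) q \<partial>?\<sigma>)"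
  proof (intro nn_integral_cong)
    fix q :: heis
    have [measurable]: "ball q (3 * s) \<in> sets borel" by simp
    have "(\<integral>\<^sup>+p. F p q \<partial>heis_lborel) =
        (\<integral>\<^sup>+p. indicator (?J \<inter> ball q (3 * s)) p * indicator (ball p0 (4 * R)) q \<partial>heis_lborel)"
      by (intro nn_integral_cong) (auto simp: F_def indicator_def dist_commute)
    also have "\<dots> = (\<integral>\<^sup>+p. indicator (?J \<inter> ball q (3 * s)) p \<partial>heis_lborel) * indicator (ball p0 (4 * R)) q"
      by (intro nn_integral_multc) measurable
    also have "(\<integral>\<^sup>+p. indicator (?J \<inter> ball q (3 * s)) p \<partial>heis_lborel) = emeasure heis_lborel (?J \<inter> ball q (3 * s))"
      by (intro nn_integral_indicator) measurable
    finally show "(\<integral>\<^sup>+p. F p q \<partial>heis_lborel) =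
        emeasure heis_lborel (?J \<inter> ball q (3 * s)) * indicator (ball p0 (4 * R)) q" .
  qed
  finally show ?thesis .
qed

text \<open>If the frontier lies in a box, \<open>\<Omega>\<close> contains all or nothing of the connected complement of the box.\<close>

lemma vertical_diff_le_diam:
  assumes \<Omega>: "open \<Omega>" and p0: "p0 \<in> frontier \<Omega>" and R: "0 < R"
  shows "vertical_diff \<Omega> (ball p0 R) s \<le>
    ennreal (4 * enn2real (min (ennreal R) (ediam (frontier \<Omega>))) ^ 4)"
proof (cases "ennreal R \<le> ediam (frontier \<Omega>)")
  case True
  note [measurable] = vertical_jump_borel[OF \<Omega>, of s]
  have "vertical_diff \<Omega> (ball p0 R) s \<le> emeasure heis_lborel (ball p0 R)"
    by (auto simp: vertical_diff_eq[OF \<Omega>] intro!: emeasure_mono)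
  also have "\<dots> \<le> ennreal (2 * R ^ 4)"
    by (rule emeasure_ball_le)
  also have "\<dots> \<le> ennreal (4 * R ^ 4)"
    using R by (intro ennreal_leI) simp
  finally show ?thesis
    using True R by (simp add: min_def)
next
  case False
  then obtain D where D: "0 \<le> D" "ediam (frontier \<Omega>) = ennreal D"
    by (cases "ediam (frontier \<Omega>)") auto
  let ?B = "hbox p0 D"
  have sub: "frontier \<Omega> \<subseteq> ?B"
  proof
    fix x assume "x \<in> frontier \<Omega>"
    then have "dist p0 x \<le> D"
      using dist_le_ediam[OF p0, of x] D by simp
    then show "x \<in> ?B"
      using cball_subset_hbox[of p0 D] by auto
  qed
  \<comment> \<open>Outside the box there is no change of sides, so \<open>p\<close> or its
    translate lies in the box. Two boxes of volume \<open>2 * D ^ 4\<close> give the factor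
    4.\<close>
  have jump: "vertical_jump \<Omega> s \<subseteq> ?B \<union> vshift (s\<^sup>2) -` ?B"
  proof
    fix p assume p: "p \<in> vertical_jump \<Omega> s"
    show "p \<in> ?B \<union> vshift (s\<^sup>2) -` ?B"
    proof (rule ccontr)
      assume "p \<notin> ?B \<union> vshift (s\<^sup>2) -` ?B"
      then obtain w where "w \<in> - ?B" "w \<in> frontier \<Omega>"
        using connected_jump_frontier[OF connected_Compl_hbox, of p p0 D "vshift (s\<^sup>2) p" \<Omega>] p
        by (auto simp: vertical_jump_def)
      then show False using sub by blast
    qed
  qed
  have "vertical_diff \<Omega> (ball p0 R) s \<le> emeasure heis_lborel (?B \<union> vshift (s\<^sup>2) -` ?B)"
    unfolding vimage_vshift_hbox using jump[unfolded vimage_vshift_hbox]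
    by (auto simp: vertical_diff_eq[OF \<Omega>] intro!: emeasure_mono)
  also have "\<dots> \<le> emeasure heis_lborel ?B + emeasure heis_lborel (vshift (s\<^sup>2) -` ?B)"
    unfolding vimage_vshift_hbox by (intro emeasure_subadditive) auto
  also have "\<dots> = ennreal (4 * D ^ 4)"
    using D by (simp add: vimage_vshift_hbox emeasure_hbox ennreal_plus[symmetric] del: ennreal_plus)
  finally show ?thesis
    using False D by (simp add: min_def)
qed

text \<open>The integrand is \<open>c powr p * s powr (- p - 1)\<close>, with integral
  \<open>(c / a) powr p / p\<close>; the factor \<open>1 / p\<close> is then estimated by 1.\<close>

lemma nn_integral_tail_powr_le:
  assumes a: "0 < a" and p: "1 \<le> p" and c: "0 \<le> c"
  shows "(\<integral>\<^sup>+s. enn_powr (ennreal (c / s)) p * ennreal (1 / s) * indicator {a..} s \<partial>lborel) \<le>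
    ennreal ((c / a) powr p)"
proof -
  have "((\<lambda>s. c powr p * s powr (- p - 1)) has_integral c powr p * (- (a powr (- p - 1 + 1)) / (- p - 1 + 1))) {a..}"
    using a p by (intro has_integral_mult_right has_integral_powr_to_inf) auto
  moreover have "0 \<le> c powr p * s powr (- p - 1)" for s by simp
  moreover have "c powr p * (- (a powr (- p - 1 + 1)) / (- p - 1 + 1)) = (c / a) powr p / p"
    using a c by (simp add: powr_divide powr_minus field_simps)
  ultimately have int: "(\<integral>\<^sup>+s. ennreal (c powr p * s powr (- p - 1)) * indicator {a..} s \<partial>lborel) =
      ennreal ((c / a) powr p / p)"
    by (intro nn_integral_has_integral_lebesgue') auto
  have "(\<integral>\<^sup>+s. enn_powr (ennreal (c / s)) p * ennreal (1 / s) * indicator {a..} s \<partial>lborel) =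
      (\<integral>\<^sup>+s. ennreal (c powr p * s powr (- p - 1)) * indicator {a..} s \<partial>lborel)"
  proof (intro nn_integral_cong)
    fix s
    show "enn_powr (ennreal (c / s)) p * ennreal (1 / s) * indicator {a..} s =
        ennreal (c powr p * s powr (- p - 1)) * indicator {a..} s"
    proof (cases "a \<le> s")
      case True
      then have s: "0 < s" using a by simp
      have "(c / s) powr p * (1 / s) = c powr p * s powr (- p - 1)"
        using s c by (simp add: powr_divide powr_diff powr_minus field_simps)
      then show ?thesis
        using s c by (simp add: ennreal_mult[symmetric])
    qed simp
  qed
  also have "\<dots> \<le> ennreal ((c / a) powr p)"
    unfolding int using p mult_left_mono[of 1 p "(c / a) powr p"]
    by (intro ennreal_leI) (simp add: divide_le_eq)
  finally show ?thesis .
qed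

text \<open>The powers of \<open>s\<close> cancel: \<open>A / s ^ 3\<close> comes from
  \<open>vertical_diff_le_integral\<close>, \<open>A * s ^ 4\<close> from the local bound by beta
  numbers, and the division by \<open>s\<close> removes the rest. The numbers are 8748 from the
  local bound and \<open>26 * 16 ^ 4\<close> from the minorant.\<close>

lemma vertical_diff_le_minorant:
  assumes \<Omega>: "open \<Omega>" and reg: "three_regular A (frontier \<Omega>)"
    and s: "0 < s" "s \<le> R" "ennreal s \<le> ediam (frontier \<Omega>)"
    and g: "\<And>q. \<exists>q' r. ball q (7 * s) \<subseteq> ball q' r \<and> 0 < r \<and>
      ennreal (r ^ 4) * beta1 (frontier \<Omega>) q' r \<le> ennreal (26 * (16 * s) ^ 4) * g q"
    and g_meas: "g \<in> borel_measurable borel"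
  shows "vertical_diff \<Omega> (ball p0 R) s / ennreal s \<le> ennreal (8748 * 26 * 16 ^ 4 * A\<^sup>2) *
    (\<integral>\<^sup>+q. g q * indicator (ball p0 (4 * R)) q \<partial>surface_measure (frontier \<Omega>))"
proof -
  let ?\<sigma> = "surface_measure (frontier \<Omega>)" and ?K = "8748 * 26 * 16 ^ 4 * A\<^sup>2"
  have A: "1 \<le> A" using reg by (simp add: three_regular_def)
  note [measurable] = g_meas
  have [measurable]: "ball p0 (4 * R) \<in> sets borel" by simp
  have local: "emeasure heis_lborel (vertical_jump \<Omega> s \<inter> ball q (3 * s)) \<le>
      ennreal (8748 * A * (26 * (16 * s) ^ 4)) * g q" for q
  proof -
    obtain q' r where qr: "ball q (7 * s) \<subseteq> ball q' r" "0 < r"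
      "ennreal (r ^ 4) * beta1 (frontier \<Omega>) q' r \<le> ennreal (26 * (16 * s) ^ 4) * g q"
      using g by blast
    have "emeasure heis_lborel (vertical_jump \<Omega> s \<inter> ball q (3 * s)) \<le>
        ennreal (8748 * A * r ^ 4) * beta1 (frontier \<Omega>) q' r"
      by (rule emeasure_vertical_jump_le_beta1[OF \<Omega> reg s(1,3) qr(1,2)])
    also have "\<dots> = ennreal (8748 * A) * (ennreal (r ^ 4) * beta1 (frontier \<Omega>) q' r)"
      using A qr(2) by (simp add: ennreal_mult mult.assoc)
    also have "\<dots> \<le> ennreal (8748 * A) * (ennreal (26 * (16 * s) ^ 4) * g q)"
      by (intro mult_left_mono qr(3)) simp
    also have "\<dots> = ennreal (8748 * A * (26 * (16 * s) ^ 4)) * g q"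
    proof -
      have "ennreal (8748 * A) * ennreal (26 * (16 * s) ^ 4) = ennreal (8748 * A * (26 * (16 * s) ^ 4))"
        using A s by (intro ennreal_mult[symmetric]) auto
      then show ?thesis by (simp only: mult.assoc[symmetric])
    qed
    finally show ?thesis .
  qed
  have "vertical_diff \<Omega> (ball p0 R) s \<le> ennreal (A / s ^ 3) *
      (\<integral>\<^sup>+q. emeasure heis_lborel (vertical_jump \<Omega> s \<inter> ball q (3 * s)) * indicator (ball p0 (4 * R)) q \<partial>?\<sigma>)"
    by (rule vertical_diff_le_integral[OF \<Omega> reg s])
  also have "\<dots> \<le> ennreal (A / s ^ 3) *
      (\<integral>\<^sup>+q. ennreal (8748 * A * (26 * (16 * s) ^ 4)) * (g q * indicator (ball p0 (4 * R)) q) \<partial>?\<sigma>)"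
    using local by (intro mult_left_mono nn_integral_mono) (auto simp: indicator_def)
  also have "\<dots> = ennreal (A / s ^ 3) * (ennreal (8748 * A * (26 * (16 * s) ^ 4)) *
      (\<integral>\<^sup>+q. g q * indicator (ball p0 (4 * R)) q \<partial>?\<sigma>))"
    by (subst nn_integral_cmult) measurable
  also have "\<dots> = ennreal (?K * s) * (\<integral>\<^sup>+q. g q * indicator (ball p0 (4 * R)) q \<partial>?\<sigma>)"
  proof -
    have "A / s ^ 3 * (8748 * A * (26 * (16 * s) ^ 4)) = ?K * s"
      using s by (simp add: power_mult_distrib power2_eq_square power3_eq_cube power4_eq_xxxx)
    then have "ennreal (A / s ^ 3) * ennreal (8748 * A * (26 * (16 * s) ^ 4)) = ennreal (?K * s)"
      using A s by (subst ennreal_mult[symmetric]) auto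
    then show ?thesis by (simp only: mult.assoc[symmetric])
  qed
  finally have "ennreal (1 / s) * vertical_diff \<Omega> (ball p0 R) s \<le>
      ennreal (1 / s) * (ennreal (?K * s) * (\<integral>\<^sup>+q. g q * indicator (ball p0 (4 * R)) q \<partial>?\<sigma>))"
    by (rule mult_left_mono) simp
  moreover have "ennreal (1 / s) * ennreal (?K * s) = ennreal ?K"
    using s by (subst ennreal_mult[symmetric]) auto
  moreover have "ennreal (1 / s) * vertical_diff \<Omega> (ball p0 R) s = vertical_diff \<Omega> (ball p0 R) s / ennreal s"
    using s by (simp add: divide_ennreal_def inverse_ennreal inverse_eq_divide mult.commute)
  ultimately show ?thesis by (simp only: mult.assoc[symmetric])
qed

section \<open>Integration over the scales\<close>

text \<open>The scales are cut at \<open>D\<close>, the smaller of \<open>R\<close> and the diameter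
  of the frontier. Below \<open>D\<close>, regularity is available and Minkowski's inequality moves
  the integral over the frontier outside; above \<open>D\<close>, the trivial bound
  \<open>4 * D ^ 4\<close> contributes \<open>4 * D ^ 3\<close>, which \<open>R ^ 3\<close>
  absorbs.\<close>

lemma vertical_perimeter_le:
  assumes p: "1 \<le> p" and \<Omega>: "open \<Omega>" and reg: "three_regular A (frontier \<Omega>)"
    and p0: "p0 \<in> frontier \<Omega>" and R: "0 < R"
  shows "vertical_perimeter p \<Omega> (ball p0 R) \<le>
    ennreal (2 * (8748 * 26 * 16 ^ 4 * A\<^sup>2)) * (ennreal (R ^ 3) +
      (\<integral>\<^sup>+q\<in>ball p0 (18 * R) \<inter> frontier \<Omega>.
        enn_powr (\<integral>\<^sup>+r\<in>{0<..R}. enn_powr (beta1 (frontier \<Omega>) q (18 * r)) p * ennreal (1 / r) \<partial>lborel) (1 / p)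
        \<partial>hausdorff_measure 3))"
    (is "_ \<le> _ * (_ + ?I)")
proof -
  let ?E = "frontier \<Omega>" and ?\<sigma> = "surface_measure (frontier \<Omega>)"
  define K where "K = 8748 * 26 * 16 ^ 4 * A\<^sup>2"
  define D where "D = enn2real (min (ennreal R) (ediam ?E))"
  let ?v = "vertical_diff \<Omega> (ball p0 R)"
  have A: "1 \<le> A" using reg by (simp add: three_regular_def)
  have K: "4 \<le> K"
  proof -
    have "4 * 1 \<le> 8748 * 26 * 16 ^ 4 * A\<^sup>2"
      using A by (intro mult_mono one_le_power) auto
    then show ?thesis
      unfolding K_def by (simp only: mult_1_right)
  qed
  have D_eq: "ennreal D = min (ennreal R) (ediam ?E)"
    by (simp add: D_def min_less_iff_disj)
  have D: "0 \<le> D" "D \<le> R"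
  proof -
    show "0 \<le> D" by (simp add: D_def)
    have "ennreal D \<le> ennreal R" by (simp add: D_eq)
    then show "D \<le> R" using R by simp
  qed
  have trivial: "?v s \<le> ennreal (4 * D ^ 4)" for s
    unfolding D_def by (rule vertical_diff_le_diam[OF \<Omega> p0 R])
  show ?thesis
  proof (cases "D = 0")
    case True
    \<comment> \<open>The frontier has diameter zero, so regularity says nothing at any positive
      radius, but the trivial bound already vanishes.\<close>
    then have "?v s = 0" for s
      using trivial[of s] by simp
    then show ?thesis
      by (simp add: vertical_perimeter_def)
  next
    case False
    then have D0: "0 < D" using D by simp
    have cl: "closed ?E" by simp
    obtain g where g_meas [measurable]: "g \<in> borel_measurable (borel \<Otimes>\<^sub>M borel)"
      and g_le: "\<And>s q. 0 < s \<Longrightarrow> g (s, q) \<le> beta1 ?E q (18 * s)"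
      and g_ge: "\<And>s q. 0 < s \<Longrightarrow> \<exists>q' r. ball q (7 * s) \<subseteq> ball q' r \<and> 0 < r \<and>
        ennreal (r ^ 4) * beta1 ?E q' r \<le> ennreal (26 * (16 * s) ^ 4) * g (s, q)"
      using beta1_measurable_minorant[OF cl] by blast
    have D_diam: "ennreal D \<le> ediam ?E" by (simp add: D_eq)
    have sfS: "sigma_finite_measure ?\<sigma>"
      by (rule sigma_finite_surface_measure[OF reg D0 D_diam])
    interpret S: sigma_finite_measure ?\<sigma> by (rule sfS)
    \<comment> \<open>This is \<open>ds / s\<close> on the scales up to \<open>D\<close>, turned
      into a measure for Minkowski's inequality.\<close>
    define \<nu> :: "real measure" where "\<nu> = density lborel (\<lambda>s. ennreal (1 / s) * indicator {0<..D} s)"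
    have sets_\<nu> [simp, measurable_cong]: "sets \<nu> = sets borel"
      by (simp add: \<nu>_def)
    have sf\<nu>: "sigma_finite_measure \<nu>"
      unfolding \<nu>_def by (subst sigma_finite_measure.sigma_finite_iff_density_finite[OF lborel.sigma_finite_measure_axioms]) (auto simp: indicator_def)
    interpret N: sigma_finite_measure \<nu> by (rule sf\<nu>)
    have [measurable]: "ball p0 (4 * R) \<in> sets borel" by simp
    define h where "h = (\<lambda>(s, q). g (s, q) * indicator (ball p0 (4 * R)) q)"
    have h_meas [measurable]: "h \<in> borel_measurable (borel \<Otimes>\<^sub>M borel)"
      unfolding h_def by measurable
    have h_meas' [measurable]: "h \<in> borel_measurable (\<nu> \<Otimes>\<^sub>M ?\<sigma>)"
      by measurable
    define G where "G s = (\<integral>\<^sup>+q. h (s, q) \<partial>?\<sigma>)" for s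
    have G_meas [measurable]: "G \<in> borel_measurable borel"
      unfolding G_def by measurable
    have small: "?v s / ennreal s \<le> ennreal K * G s" if s: "0 < s" "s \<le> D" for s
    proof -
      have "ennreal s \<le> ennreal D" using s by (intro ennreal_leI) simp
      then have "ennreal s \<le> ediam ?E" using D_diam by (rule order_trans)
      moreover have "(\<lambda>q. g (s, q)) \<in> borel_measurable borel" by measurable
      ultimately show ?thesis
        unfolding K_def G_def h_def case_prod_conv using s D
        by (intro vertical_diff_le_minorant[OF \<Omega> reg] g_ge) auto
    qed
    have large: "?v s / ennreal s \<le> ennreal (4 * D ^ 4 / s)" if "0 < s" for s
      using divide_right_mono_ennreal[OF trivial[of s], of "ennreal s"] that D by (simp add: divide_ennreal)
    define F1 where "F1 s = enn_powr (ennreal K * G s) p * (ennreal (1 / s) * indicator {0<..D} s)" for s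
    define F2 where "F2 s = enn_powr (ennreal (4 * D ^ 4 / s)) p * ennreal (1 / s) * indicator {D..} s" for s
    have [measurable]: "F1 \<in> borel_measurable borel" "F2 \<in> borel_measurable borel"
      unfolding F1_def F2_def by measurable
    have split: "enn_powr (?v s / ennreal s) p * ennreal (1 / s) * indicator {0<..} s \<le> F1 s + F2 s" for s
    proof -
      consider "s \<le> 0" | "0 < s" "s \<le> D" | "0 < s" "D \<le> s" by linarith
      then show ?thesis
      proof cases
        case 2
        then have "enn_powr (?v s / ennreal s) p * ennreal (1 / s) * indicator {0<..} s \<le> F1 s"
          using enn_powr_mono[OF _ small[OF 2], of p] p by (simp add: F1_def mult_right_mono)
        then show ?thesis by (rule order_trans) simp
      next
        case 3
        then have "enn_powr (?v s / ennreal s) p * ennreal (1 / s) * indicator {0<..} s \<le> F2 s"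
          using enn_powr_mono[OF _ large[OF 3(1)], of p] p by (simp add: F2_def mult_right_mono)
        then show ?thesis by (rule order_trans) simp
      qed simp
    qed
    have "vertical_perimeter p \<Omega> (ball p0 R) \<le> enn_powr (\<integral>\<^sup>+s. F1 s + F2 s \<partial>lborel) (1 / p)"
      unfolding vertical_perimeter_def using p by (intro enn_powr_mono nn_integral_mono split) auto
    also have "\<dots> = enn_powr ((\<integral>\<^sup>+s. F1 s \<partial>lborel) + (\<integral>\<^sup>+s. F2 s \<partial>lborel)) (1 / p)"
      by (simp add: nn_integral_add)
    also have "\<dots> \<le> 2 * (enn_powr (\<integral>\<^sup>+s. F1 s \<partial>lborel) (1 / p) + enn_powr (\<integral>\<^sup>+s. F2 s \<partial>lborel) (1 / p))"
      by (rule enn_powr_add_le[OF p])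
    also have "\<dots> \<le> 2 * (ennreal K * ?I + ennreal K * ennreal (R ^ 3))"
    proof (intro mult_left_mono add_mono)
      have "enn_powr (\<integral>\<^sup>+s. F2 s \<partial>lborel) (1 / p) \<le> enn_powr (ennreal ((4 * D ^ 4 / D) powr p)) (1 / p)"
        unfolding F2_def using p D0 by (intro enn_powr_mono nn_integral_tail_powr_le) auto
      also have "\<dots> = ennreal (4 * D ^ 3)"
        using p D0 by (simp add: powr_powr power3_eq_cube power4_eq_xxxx)
      also have "\<dots> \<le> ennreal (K * R ^ 3)"
        using D K R by (intro ennreal_leI mult_mono power_mono) auto
      finally show "enn_powr (\<integral>\<^sup>+s. F2 s \<partial>lborel) (1 / p) \<le> ennreal K * ennreal (R ^ 3)"
        using K R by (simp add: ennreal_mult)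
      \<comment> \<open>The minorant carried by \<open>h\<close> serves Fubini and Minkowski; the
        passage to \<open>beta1\<close>, here and in the outer integral, uses only monotonicity of
        the integral.\<close>
      have inner: "(\<integral>\<^sup>+s. enn_powr (h (s, q)) p \<partial>\<nu>) \<le>
          (\<integral>\<^sup>+r\<in>{0<..R}. enn_powr (beta1 ?E q (18 * r)) p * ennreal (1 / r) \<partial>lborel)" for q
      proof -
        have "(\<integral>\<^sup>+s. enn_powr (h (s, q)) p \<partial>\<nu>) =
            (\<integral>\<^sup>+s. ennreal (1 / s) * indicator {0<..D} s * enn_powr (h (s, q)) p \<partial>lborel)"
          unfolding \<nu>_def by (intro nn_integral_density) measurable
        also have "\<dots> \<le> (\<integral>\<^sup>+r\<in>{0<..R}. enn_powr (beta1 ?E q (18 * r)) p * ennreal (1 / r) \<partial>lborel)"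
        proof (intro nn_integral_mono)
          fix s :: real
          show "ennreal (1 / s) * indicator {0<..D} s * enn_powr (h (s, q)) p \<le>
              enn_powr (beta1 ?E q (18 * s)) p * ennreal (1 / s) * indicator {0<..R} s"
          proof (cases "s \<in> {0<..D}")
            case True
            then have "h (s, q) \<le> beta1 ?E q (18 * s)"
              using g_le[of s q] by (auto simp: h_def indicator_def)
            then have "enn_powr (h (s, q)) p \<le> enn_powr (beta1 ?E q (18 * s)) p"
              using p by (intro enn_powr_mono) auto
            then show ?thesis
              using True D by (simp add: mult.commute mult_left_mono)
          qed simp
        qed
        finally show ?thesis .
      qed
      define m where "m q = enn_powr (\<integral>\<^sup>+s. enn_powr (h (s, q)) p \<partial>\<nu>) (1 / p)" for q
      have m_meas: "m \<in> borel_measurable borel"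
        unfolding m_def by measurable
      have "(\<integral>\<^sup>+s. F1 s \<partial>lborel) = (\<integral>\<^sup>+s. enn_powr (ennreal K * G s) p \<partial>\<nu>)"
        unfolding \<nu>_def F1_def by (subst nn_integral_density) (auto intro!: nn_integral_cong simp: mult.commute)
      also have "\<dots> = (\<integral>\<^sup>+s. ennreal (K powr p) * enn_powr (G s) p \<partial>\<nu>)"
        using K by (simp add: enn_powr_mult_left)
      also have "\<dots> = ennreal (K powr p) * (\<integral>\<^sup>+s. enn_powr (G s) p \<partial>\<nu>)"
        by (intro nn_integral_cmult) measurable
      finally have "enn_powr (\<integral>\<^sup>+s. F1 s \<partial>lborel) (1 / p) =
          ennreal K * enn_powr (\<integral>\<^sup>+s. enn_powr (G s) p \<partial>\<nu>) (1 / p)"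
        using K p by (simp add: enn_powr_mult_left powr_powr)
      also have "\<dots> \<le> ennreal K * (\<integral>\<^sup>+q. m q \<partial>?\<sigma>)"
        unfolding G_def m_def by (intro mult_left_mono nn_integral_Minkowski[OF sf\<nu> sfS p h_meas']) simp
      also have "(\<integral>\<^sup>+q. m q \<partial>?\<sigma>) = (\<integral>\<^sup>+q. m q * indicator ?E q \<partial>hausdorff_measure 3)"
        by (rule nn_integral_surface_measure[OF cl m_meas])
      also have "\<dots> \<le> ?I"
      proof (intro nn_integral_mono)
        fix q
        show "m q * indicator ?E q \<le>
            enn_powr (\<integral>\<^sup>+r\<in>{0<..R}. enn_powr (beta1 ?E q (18 * r)) p * ennreal (1 / r) \<partial>lborel) (1 / p) *
            indicator (ball p0 (18 * R) \<inter> ?E) q"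
        \<comment> \<open>The integral reaches only as far as \<open>4 * R\<close>; the ball is
          enlarged so that 18 serves as the constant for both radii.\<close>
        proof (cases "q \<in> ball p0 (4 * R)")
          case True
          then have "q \<in> ball p0 (18 * R)" using R by auto
          moreover have "m q \<le> enn_powr (\<integral>\<^sup>+r\<in>{0<..R}. enn_powr (beta1 ?E q (18 * r)) p * ennreal (1 / r) \<partial>lborel) (1 / p)"
            unfolding m_def using p by (intro enn_powr_mono inner) auto
          ultimately show ?thesis
            by (auto simp: indicator_def)
        next
          case False
          then have "m q = 0" by (simp add: m_def h_def)
          then show ?thesis by simp
        qed
      qed
      finally show "enn_powr (\<integral>\<^sup>+s. F1 s \<partial>lborel) (1 / p) \<le> ennreal K * ?I"
        by (simp add: mult_left_mono)
    qed simp
    also have "\<dots> = ennreal (2 * K) * (ennreal (R ^ 3) + ?I)"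
      using K by (simp add: ennreal_mult distrib_left mult.assoc add.commute)
    finally show ?thesis
      by (simp only: K_def)
  qed
qed

theorem proposition6p2:
  shows "\<exists>C::real. C \<ge> 1 \<and>
    (\<forall>p::real. \<forall>A::real. p \<ge> 1 \<longrightarrow> A \<ge> 1 \<longrightarrow>
      (\<exists>K::real. K > 0 \<and>
        (\<forall>(\<Omega> :: heis set) (p0 :: heis) (R :: real).
          open \<Omega> \<longrightarrow> \<Omega> \<noteq> {} \<longrightarrow> three_regular A (frontier \<Omega>) \<longrightarrow>
          p0 \<in> frontier \<Omega> \<longrightarrow> 0 < R \<longrightarrow> ennreal R \<le> ediam \<Omega> \<longrightarrow>
          vertical_perimeter p \<Omega> (ball p0 R) \<le>
            ennreal K * (ennreal (R ^ 3) +
              (\<integral>\<^sup>+q\<in>ball p0 (C * R) \<inter> frontier \<Omega>.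
                enn_powr (\<integral>\<^sup>+r\<in>{0<..R}. enn_powr (beta1 (frontier \<Omega>) q (C * r)) p * ennreal (1 / r) \<partial>lborel) (1 / p)
                \<partial>hausdorff_measure 3)))))"
proof (rule exI[of _ 18], intro conjI allI impI)
  fix p A :: real
  assume "1 \<le> p" "1 \<le> A"
  then show "\<exists>K::real. K > 0 \<and>
        (\<forall>(\<Omega> :: heis set) (p0 :: heis) (R :: real).
          open \<Omega> \<longrightarrow> \<Omega> \<noteq> {} \<longrightarrow> three_regular A (frontier \<Omega>) \<longrightarrow>
          p0 \<in> frontier \<Omega> \<longrightarrow> 0 < R \<longrightarrow> ennreal R \<le> ediam \<Omega> \<longrightarrow>
          vertical_perimeter p \<Omega> (ball p0 R) \<le>
            ennreal K * (ennreal (R ^ 3) +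
              (\<integral>\<^sup>+q\<in>ball p0 (18 * R) \<inter> frontier \<Omega>.
                enn_powr (\<integral>\<^sup>+r\<in>{0<..R}. enn_powr (beta1 (frontier \<Omega>) q (18 * r)) p * ennreal (1 / r) \<partial>lborel) (1 / p)
                \<partial>hausdorff_measure 3)))"
    \<comment> \<open>The value 18 is the radius factor in \<open>beta1_measurable_minorant\<close>,
      and the multiplicative constant depends on \<open>A\<close> alone.\<close>
    by (intro exI[of _ "2 * (8748 * 26 * 16 ^ 4 * A\<^sup>2)"] conjI allI impI vertical_perimeter_le) auto
qed simp

end
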